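(* Let $(n,\mathbf{V},p)$ be a solution of the pressure-based hydrodynamic space discretization (written out in the context) with the Lorentz force term omitted. Then the total hydrodynamic energy $$H(n,\mathbf{V},p)=\int_\Omega\left(\frac12m_in|\mathbf{V}|^2+\frac{p}{\gamma-1}\right)dx$$ is conserved: $\frac{dH}{dt}=0$.
   Context: $\Omega\subset\mathbb{R}^3$ is a bounded domain (possibly periodic, in which case boundary conditions are absent) with a finite element mesh, $\mathbf{n}$ its outward unit normal, $\langle\cdot,\cdot\rangle$ the $L^2(\Omega)$ inner product, with derivatives of discontinuous fields taken cell-wise. $\mathbb{V}_2\subset H(\mathrm{div};\Omega)$ and $\mathbb{V}_3\subset L^2(\Omega)$ are finite-dimensional finite element spaces of cell-wise smooth functions with $\nabla\cdot\mathbb{V}_2\subset\mathbb{V}_3$ and constants in $\mathbb{V}_3$ (part of a discrete de Rham complex). $\mathring{\mathbb{V}}_2=\{\mathbf{w}\in\mathbb{V}_2:\mathbf{w}\cdot\mathbf{n}|_{\partial\Omega}=0\}$. $\Gamma$ is the set of interior mesh facets, sides arbitrarily labelled $+,-$, unit facet normals $\mathbf{n}^+=-\mathbf{n}^-$. For vector fields $\mathbf{u}$: $[\![\mathbf{u}]\!]=\mathbf{u}^+\cdot\mathbf{n}^++\mathbf{u}^-\cdot\mathbf{n}^-$, $\{\!\{\mathbf{n}\times\mathbf{u}\}\!\}=\mathbf{n}^+\times\mathbf{u}^++\mathbf{n}^-\times\mathbf{u}^-$. Upwind values with respect to $\mathbf{V}$: for $a\in\{n,p,\mathbf{V}\}$,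 $\tilde a=a^+$ if $\mathbf{V}^+\cdot\mathbf{n}^+<0$ and $\tilde a=a^-$ otherwise. $m_i>0$ and $\gamma=5/3$ are constants. Pressure-based hydrodynamic discretization (Lorentz term omitted): time-differentiable $(n,\mathbf{V},p)\in(\mathbb{V}_3,\mathring{\mathbb{V}}_2,\mathbb{V}_3)$ with $$\Big\langle\phi,\frac{\partial n}{\partial t}\Big\rangle-\langle\nabla\phi,n\mathbf{V}\rangle+\int_\Gamma[\![\phi\mathbf{V}]\!]\tilde n\,dS=0\quad\forall\phi\in\mathbb{V}_3,$$ $$\Big\langle m_in\mathbf{w},\frac{\partial\mathbf{V}}{\partial t}\Big\rangle+\langle\nabla\times(m_in\,\mathbf{w}\times\mathbf{V}),\mathbf{V}\rangle-\int_\Gamma\{\!\{\mathbf{n}\times(m_in\,\mathbf{w}\times\mathbf{V})\}\!\}\cdot\tilde{\mathbf{V}}\,dS+\langle\nabla P,n\mathbf{w}\rangle-\int_\Gamma[\![P\mathbf{w}]\!]\tilde n\,dS-\langle p,\nabla\cdot\mathbf{w}\rangle=0\quad\forall\mathbf{w}\in\mathring{\mathbb{V}}_2,$$ $$\Big\langle\frac{\phi}{\gamma-1},\frac{\partial p}{\partial t}\Big\rangle-\Big\langle\frac1{\gamma-1}\nabla\phi,p\mathbf{V}\Big\rangle+\int_\Gamma\frac{1}{\gamma-1}[\![\phi\mathbf{V}]\!]\tilde p\,dS+\langle\phi p,\nabla\cdot\mathbf{V}\rangle=0\quad\forall\phi\in\mathbb{V}_3,$$ where $P\in\mathbb{V}_3$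 is defined by $\langle\phi,P-\frac{m_i}2|\mathbf{V}|^2\rangle=0$ for all $\phi\in\mathbb{V}_3$. *)

theory Defs
  imports "HOL-Analysis.Analysis"
begin

section \<open>Differential operators and smoothness on three-dimensional space\<close>

type_synonym point = "real^3"

definition pd :: "3 \<Rightarrow> (point \<Rightarrow> 'b::real_normed_vector) \<Rightarrow> point \<Rightarrow> 'b" where
  "pd i f x = frechet_derivative f (at x) (axis i 1)"

definition grad :: "(point \<Rightarrow> real) \<Rightarrow> point \<Rightarrow> point" where
  "grad f x = (\<chi> i. pd i f x)"

definition divergence :: "(point \<Rightarrow> point) \<Rightarrow> point \<Rightarrow> real" where
  "divergence u x = (\<Sum>i\<in>UNIV. pd i u x $ i)"

definition curl :: "(point \<Rightarrow> point) \<Rightarrow> point \<Rightarrow> point" where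
  "curl u x = vector [pd 2 u x $ 3 - pd 3 u x $ 2,
                      pd 3 u x $ 1 - pd 1 u x $ 3,
                      pd 1 u x $ 2 - pd 2 u x $ 1]"

text \<open>These are meant for open sets \<open>U\<close>.\<close>

primrec Ck_on :: "nat \<Rightarrow> point set \<Rightarrow> (point \<Rightarrow> 'b::real_normed_vector) \<Rightarrow> bool" where
  "Ck_on 0 U f \<longleftrightarrow> continuous_on U f"
| "Ck_on (Suc k) U f \<longleftrightarrow> f differentiable_on U \<and> (\<forall>i. Ck_on k U (pd i f))"

definition smooth_on :: "point set \<Rightarrow> (point \<Rightarrow> 'b::real_normed_vector) \<Rightarrow> bool" where
  "smooth_on U f \<longleftrightarrow> (\<forall>k. Ck_on k U f)"

section \<open>Surface measure\<close>

text \<open>Two-dimensional Hausdorff outer measure, normalised by \<open>pi/4\<close> so that it is the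
  ordinary surface area on smooth surfaces.  It is countably additive on Borel sets.
  Boundedness of the covering sets is required because \<^const>\<open>diameter\<close> is only
  meaningful for bounded sets.\<close>

definition hausdorff2 :: "point set \<Rightarrow> ennreal" where
  "hausdorff2 A = (SUP \<delta>\<in>{0<..}. INF C\<in>{C :: nat \<Rightarrow> point set.
       A \<subseteq> (\<Union>i. C i) \<and> (\<forall>i. bounded (C i) \<and> diameter (C i) \<le> \<delta>)}.
       \<Sum>i. ennreal (pi / 4 * (diameter (C i))\<^sup>2))"

definition surface_measure :: "point measure" where
  "surface_measure = measure_of UNIV (sets borel) hausdorff2"

section \<open>Meshes of (possibly periodic) domains\<close>

text \<open>A periodic domain is represented by its lift \<open>domain\<close>, an open set that is invariant
  under the lattice generated by \<open>periods\<close>; fields on it are the periodic functions.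
  An ordinary bounded domain is the case \<open>periods = {}\<close>, where the lattice is \<open>{0}\<close> and
  all periodicity conditions are void; a triply periodic domain is the case of three periods
  and \<open>domain = UNIV\<close>, where there are no boundary facets.
  \<open>cells\<close> and \<open>ifacets\<close> contain one representative of each class modulo the lattice; the
  two cells adjacent to a representative facet may be translates of representative cells.
  Cells are the open element interiors, facet surfaces are without their edges.\<close>

record interior_facet =
  surf :: "point set"
  plus_cell :: "point set"
  minus_cell :: "point set"
  nplus :: "point \<Rightarrow> point"

record boundary_facet =
  bsurf :: "point set"
  bcell :: "point set"
  bnormal :: "point \<Rightarrow> point"

record mesh =
  domain :: "point set"
  periods :: "point set"
  cells :: "point set set"
  ifacets :: "interior_facet set"
  bfacets :: "boundary_facet set"

definition lattice_of :: "mesh \<Rightarrow> point set" where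
  "lattice_of M = {\<Sum>b\<in>periods M. of_int (k b) *\<^sub>R b | k :: point \<Rightarrow> int. True}"

definition all_cells :: "mesh \<Rightarrow> point set set" where
  "all_cells M = {(+) v ` K | v K. v \<in> lattice_of M \<and> K \<in> cells M}"

text \<open>Near \<open>x\<close>, the set \<open>F\<close> is a smooth surface with \<open>K\<close> exactly on one side and \<open>L\<close>
  exactly on the other, and \<open>\<nu>\<close> is the unit normal of \<open>F\<close> at \<open>x\<close> pointing out of \<open>K\<close>.\<close>

definition separates_at ::
  "point set \<Rightarrow> point set \<Rightarrow> point set \<Rightarrow> point \<Rightarrow> point \<Rightarrow> bool" where
  "separates_at F K L x \<nu> \<longleftrightarrow> (\<exists>U (\<rho> :: point \<Rightarrow> real). open U \<and> x \<in> U \<and> smooth_on U \<rho> \<and>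
      (\<forall>y\<in>U. grad \<rho> y \<noteq> 0) \<and>
      K \<inter> U = {y\<in>U. \<rho> y < 0} \<and> F \<inter> U = {y\<in>U. \<rho> y = 0} \<and> L \<inter> U = {y\<in>U. \<rho> y > 0} \<and>
      \<nu> = sgn (grad \<rho> x))"

definition interior_facet_of :: "mesh \<Rightarrow> interior_facet \<Rightarrow> bool" where
  "interior_facet_of M F \<longleftrightarrow>
     surf F \<noteq> {} \<and> surf F \<subseteq> domain M \<and> surf F \<in> sets borel \<and> hausdorff2 (surf F) < \<infinity> \<and>
     plus_cell F \<in> all_cells M \<and> minus_cell F \<in> all_cells M \<and>
     surf F \<subseteq> frontier (plus_cell F) \<inter> frontier (minus_cell F) \<and>
     (\<forall>x\<in>surf F. separates_at (surf F) (plus_cell F) (minus_cell F) x (nplus F x))"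

definition boundary_facet_of :: "mesh \<Rightarrow> boundary_facet \<Rightarrow> bool" where
  "boundary_facet_of M F \<longleftrightarrow>
     bsurf F \<noteq> {} \<and> bsurf F \<subseteq> frontier (domain M) \<and> bcell F \<in> cells M \<and>
     bsurf F \<subseteq> frontier (bcell F) \<and>
     (\<forall>x\<in>bsurf F. separates_at (bsurf F) (bcell F) (- closure (bcell F)) x (bnormal F x))"

text \<open>Boundedness of the domain (modulo the periods) follows from its being covered by the
  closures of finitely many bounded cells (and their translates).  The last condition says
  that the facets exhaust the boundary of each cell up to edges and vertices.\<close>

definition fe_mesh :: "mesh \<Rightarrow> bool" where
  "fe_mesh M \<longleftrightarrow>
     independent (periods M) \<and>
     open (domain M) \<and> connected (domain M) \<and> domain M \<noteq> {} \<and>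
     (\<forall>v\<in>lattice_of M. (+) v ` domain M = domain M) \<and>
     finite (cells M) \<and> finite (ifacets M) \<and> finite (bfacets M) \<and>
     (\<forall>K\<in>cells M. open K \<and> connected K \<and> K \<noteq> {} \<and> bounded K \<and> negligible (frontier K)) \<and>
     (\<forall>v\<in>lattice_of M. \<forall>w\<in>lattice_of M. \<forall>K\<in>cells M. \<forall>L\<in>cells M.
        (+) v ` K \<inter> (+) w ` L \<noteq> {} \<longrightarrow> v = w \<and> K = L) \<and>
     \<Union>(all_cells M) \<subseteq> domain M \<and> domain M \<subseteq> \<Union>(closure ` all_cells M) \<and>
     (\<forall>F\<in>ifacets M. interior_facet_of M F) \<and>
     (\<forall>F\<in>bfacets M. boundary_facet_of M F) \<and>
     (\<forall>F\<in>ifacets M. \<forall>G\<in>ifacets M. \<forall>v\<in>lattice_of M.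
        surf F \<inter> (+) v ` surf G \<noteq> {} \<longrightarrow> v = 0 \<and> F = G) \<and>
     (\<forall>K\<in>cells M. hausdorff2 (frontier K
        - \<Union>{(+) v ` surf F | v F. v \<in> lattice_of M \<and> F \<in> ifacets M \<and>
              ((+) v ` plus_cell F = K \<or> (+) v ` minus_cell F = K)}
        - \<Union>{bsurf F | F. F \<in> bfacets M \<and> bcell F = K}) = 0)"

section \<open>Fields, traces and integrals\<close>

text \<open>Values of fields on the (null) skeleton of the mesh are irrelevant throughout.\<close>

definition periodic_field :: "mesh \<Rightarrow> (point \<Rightarrow> 'b) \<Rightarrow> bool" where
  "periodic_field M f \<longleftrightarrow> (\<forall>v\<in>lattice_of M. \<forall>x\<in>\<Union>(cells M). f (v + x) = f x)"

text \<open>Smooth up to the boundary on each cell.\<close>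

definition cellwise_smooth :: "mesh \<Rightarrow> (point \<Rightarrow> 'b::real_normed_vector) \<Rightarrow> bool" where
  "cellwise_smooth M f \<longleftrightarrow> periodic_field M f \<and>
     (\<forall>K\<in>cells M. \<exists>U g. open U \<and> closure K \<subseteq> U \<and> smooth_on U g \<and> (\<forall>x\<in>K. f x = g x))"

definition trace_from :: "point set \<Rightarrow> (point \<Rightarrow> 'b::t2_space) \<Rightarrow> point \<Rightarrow> 'b" where
  "trace_from K f x = Lim (at x within K) f"

abbreviation trp :: "interior_facet \<Rightarrow> (point \<Rightarrow> 'b::t2_space) \<Rightarrow> point \<Rightarrow> 'b" where
  "trp F \<equiv> trace_from (plus_cell F)"

abbreviation trm :: "interior_facet \<Rightarrow> (point \<Rightarrow> 'b::t2_space) \<Rightarrow> point \<Rightarrow> 'b" where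
  "trm F \<equiv> trace_from (minus_cell F)"

abbreviation nminus :: "interior_facet \<Rightarrow> point \<Rightarrow> point" where
  "nminus F x \<equiv> - nplus F x"

definition jump :: "interior_facet \<Rightarrow> (point \<Rightarrow> point) \<Rightarrow> point \<Rightarrow> real" where
  "jump F u x = trp F u x \<bullet> nplus F x + trm F u x \<bullet> nminus F x"

definition tangential_jump :: "interior_facet \<Rightarrow> (point \<Rightarrow> point) \<Rightarrow> point \<Rightarrow> point" where
  "tangential_jump F u x = cross3 (nplus F x) (trp F u x) + cross3 (nminus F x) (trm F u x)"

definition upwind ::
  "interior_facet \<Rightarrow> (point \<Rightarrow> point) \<Rightarrow> (point \<Rightarrow> 'b::t2_space) \<Rightarrow> point \<Rightarrow> 'b" where
  "upwind F V a x = (if trp F V x \<bullet> nplus F x < 0 then trp F a x else trm F a x)"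

definition dom_integral :: "mesh \<Rightarrow> (point \<Rightarrow> real) \<Rightarrow> real" where
  "dom_integral M f = set_lebesgue_integral lebesgue (\<Union>(cells M)) f"

definition dom_inner ::
  "mesh \<Rightarrow> (point \<Rightarrow> 'b::real_inner) \<Rightarrow> (point \<Rightarrow> 'b) \<Rightarrow> real" where
  "dom_inner M f g = dom_integral M (\<lambda>x. f x \<bullet> g x)"

definition facet_integral :: "mesh \<Rightarrow> (interior_facet \<Rightarrow> point \<Rightarrow> real) \<Rightarrow> real" where
  "facet_integral M h =
     (\<Sum>F\<in>ifacets M. set_lebesgue_integral surface_measure (surf F) (h F))"

section \<open>Function spaces\<close>

definition L2_field :: "mesh \<Rightarrow> (point \<Rightarrow> 'b::euclidean_space) \<Rightarrow> bool" where
  "L2_field M f \<longleftrightarrow> periodic_field M f \<and> set_borel_measurable lebesgue (\<Union>(cells M)) f \<and>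
     set_integrable lebesgue (\<Union>(cells M)) (\<lambda>x. (norm (f x))\<^sup>2)"

definition test_function :: "point set \<Rightarrow> (point \<Rightarrow> real) \<Rightarrow> bool" where
  "test_function A \<phi> \<longleftrightarrow> smooth_on UNIV \<phi> \<and> (\<exists>C. compact C \<and> C \<subseteq> A \<and> (\<forall>x. x \<notin> C \<longrightarrow> \<phi> x = 0))"

text \<open>The weak divergence is a local notion, so in the periodic case it may be
  tested with compactly supported functions on the lifted domain.\<close>

definition weak_divergence :: "mesh \<Rightarrow> (point \<Rightarrow> point) \<Rightarrow> (point \<Rightarrow> real) \<Rightarrow> bool" where
  "weak_divergence M u g \<longleftrightarrow> (\<forall>\<phi>. test_function (domain M) \<phi> \<longrightarrow>
     set_lebesgue_integral lebesgue (domain M) (\<lambda>x. u x \<bullet> grad \<phi> x) =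
     - set_lebesgue_integral lebesgue (domain M) (\<lambda>x. g x * \<phi> x))"

definition Hdiv :: "mesh \<Rightarrow> (point \<Rightarrow> point) set" where
  "Hdiv M = {u. L2_field M u \<and> (\<exists>g. L2_field M g \<and> weak_divergence M u g)}"

text \<open>Function types carry no vector space instance here, so finite-dimensional function
  spaces are given by finite spanning sets.\<close>

definition fin_dim_space :: "(point \<Rightarrow> 'b::real_vector) set \<Rightarrow> bool" where
  "fin_dim_space V \<longleftrightarrow> (\<exists>B. finite B \<and> V = {\<lambda>x. \<Sum>b\<in>B. c b *\<^sub>R b x | c. True})"

definition fe_spaces ::
  "mesh \<Rightarrow> (point \<Rightarrow> point) set \<Rightarrow> (point \<Rightarrow> real) set \<Rightarrow> bool" where
  "fe_spaces M V2 V3 \<longleftrightarrow>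
     fin_dim_space V2 \<and> fin_dim_space V3 \<and>
     (\<forall>w\<in>V2. cellwise_smooth M w) \<and> (\<forall>\<phi>\<in>V3. cellwise_smooth M \<phi>) \<and>
     V2 \<subseteq> Hdiv M \<and> V3 \<subseteq> {\<phi>. L2_field M \<phi>} \<and>
     (\<forall>w\<in>V2. \<exists>q\<in>V3. \<forall>x\<in>\<Union>(cells M). q x = divergence w x) \<and>
     (\<forall>c. \<exists>q\<in>V3. \<forall>x\<in>\<Union>(cells M). q x = c)"

definition V2_ring :: "mesh \<Rightarrow> (point \<Rightarrow> point) set \<Rightarrow> (point \<Rightarrow> point) set" where
  "V2_ring M V2 =
     {w\<in>V2. \<forall>F\<in>bfacets M. \<forall>x\<in>bsurf F. trace_from (bcell F) w x \<bullet> bnormal F x = 0}"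

section \<open>The pressure-based hydrodynamic space discretization\<close>

definition dt :: "real set \<Rightarrow> (real \<Rightarrow> point \<Rightarrow> 'b::real_normed_vector) \<Rightarrow> real \<Rightarrow> point \<Rightarrow> 'b" where
  "dt T f t x = vector_derivative (\<lambda>s. f s x) (at t within T)"

text \<open>In finite-dimensional function spaces, pointwise differentiability in time is the same
  as differentiability with respect to any norm.\<close>

definition time_differentiable ::
  "mesh \<Rightarrow> real set \<Rightarrow> (real \<Rightarrow> point \<Rightarrow> 'b::real_normed_vector) \<Rightarrow> bool" where
  "time_differentiable M T f \<longleftrightarrow>
     (\<forall>t\<in>T. \<forall>x\<in>\<Union>(cells M). (\<lambda>s. f s x) differentiable (at t within T))"

definition continuity_eq ::
  "mesh \<Rightarrow> (point \<Rightarrow> real) set \<Rightarrow> (point \<Rightarrow> real) \<Rightarrow> (point \<Rightarrow> real) \<Rightarrow> (point \<Rightarrow> point) \<Rightarrow> bool" where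
  "continuity_eq M V3 n' n V \<longleftrightarrow> (\<forall>\<phi>\<in>V3.
     dom_inner M \<phi> n'
     - dom_inner M (grad \<phi>) (\<lambda>x. n x *\<^sub>R V x)
     + facet_integral M (\<lambda>F x. jump F (\<lambda>y. \<phi> y *\<^sub>R V y) x * upwind F V n x) = 0)"

definition momentum_eq ::
  "mesh \<Rightarrow> (point \<Rightarrow> point) set \<Rightarrow> real \<Rightarrow> (point \<Rightarrow> point) \<Rightarrow> (point \<Rightarrow> real) \<Rightarrow> (point \<Rightarrow> point) \<Rightarrow>
   (point \<Rightarrow> real) \<Rightarrow> (point \<Rightarrow> real) \<Rightarrow> bool" where
  "momentum_eq M V2 mi V' n V p P \<longleftrightarrow> (\<forall>w\<in>V2_ring M V2.
     dom_inner M (\<lambda>x. (mi * n x) *\<^sub>R w x) V'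
     + dom_inner M (curl (\<lambda>x. cross3 ((mi * n x) *\<^sub>R w x) (V x))) V
     - facet_integral M (\<lambda>F x.
         tangential_jump F (\<lambda>y. cross3 ((mi * n y) *\<^sub>R w y) (V y)) x \<bullet> upwind F V V x)
     + dom_inner M (grad P) (\<lambda>x. n x *\<^sub>R w x)
     - facet_integral M (\<lambda>F x. jump F (\<lambda>y. P y *\<^sub>R w y) x * upwind F V n x)
     - dom_inner M p (divergence w) = 0)"

definition pressure_eq ::
  "mesh \<Rightarrow> (point \<Rightarrow> real) set \<Rightarrow> real \<Rightarrow> (point \<Rightarrow> real) \<Rightarrow> (point \<Rightarrow> point) \<Rightarrow> (point \<Rightarrow> real) \<Rightarrow> bool" where
  "pressure_eq M V3 \<gamma> p' V p \<longleftrightarrow> (\<forall>\<phi>\<in>V3.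
     dom_inner M (\<lambda>x. \<phi> x / (\<gamma> - 1)) p'
     - dom_inner M (\<lambda>x. (1 / (\<gamma> - 1)) *\<^sub>R grad \<phi> x) (\<lambda>x. p x *\<^sub>R V x)
     + facet_integral M (\<lambda>F x.
         1 / (\<gamma> - 1) * jump F (\<lambda>y. \<phi> y *\<^sub>R V y) x * upwind F V p x)
     + dom_inner M (\<lambda>x. \<phi> x * p x) (divergence V) = 0)"

definition hydro_solution ::
  "mesh \<Rightarrow> (point \<Rightarrow> point) set \<Rightarrow> (point \<Rightarrow> real) set \<Rightarrow> real \<Rightarrow> real \<Rightarrow> real set \<Rightarrow>
   (real \<Rightarrow> point \<Rightarrow> real) \<Rightarrow> (real \<Rightarrow> point \<Rightarrow> point) \<Rightarrow> (real \<Rightarrow> point \<Rightarrow> real) \<Rightarrow> bool" where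
  "hydro_solution M V2 V3 mi \<gamma> T n V p \<longleftrightarrow>
     time_differentiable M T n \<and> time_differentiable M T V \<and> time_differentiable M T p \<and>
     (\<forall>t\<in>T. n t \<in> V3 \<and> V t \<in> V2_ring M V2 \<and> p t \<in> V3 \<and>
        continuity_eq M V3 (dt T n t) (n t) (V t) \<and>
        (\<exists>P\<in>V3. (\<forall>\<phi>\<in>V3. dom_inner M \<phi> (\<lambda>x. P x - mi / 2 * (norm (V t x))\<^sup>2) = 0) \<and>
                momentum_eq M V2 mi (dt T V t) (n t) (V t) (p t) P) \<and>
        pressure_eq M V3 \<gamma> (dt T p t) (V t) (p t))"

definition hydro_energy ::
  "mesh \<Rightarrow> real \<Rightarrow> real \<Rightarrow> (point \<Rightarrow> real) \<Rightarrow> (point \<Rightarrow> point) \<Rightarrow> (point \<Rightarrow> real) \<Rightarrow> real" where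
  "hydro_energy M mi \<gamma> n V p =
     dom_integral M (\<lambda>x. 1 / 2 * mi * n x * (norm (V x))\<^sup>2 + p x / (\<gamma> - 1))"

end

theory Submission
  imports Defs
begin

text \<open>
  Energy is conserved because each of the three equations admits a test function that turns its
  time derivative into a part of \<open>dH/dt\<close> and its spatial terms into terms of the others.
  The momentum equation is tested with \<open>V\<close>; the
  advection terms then contain \<open>V \<times> V = 0\<close> and vanish.  The continuity equation is tested with
  \<open>P\<close>; its flux terms are exactly those left over in the momentum equation.
  The pressure equation is tested with the constant 1; the gradient term vanishes, and
  \<open>\<langle>p, div V\<rangle>\<close> cancels against the pressure force.  Since \<open>dn/dt\<close> again lies in
  \<open>V3\<close>, the projection \<open>P\<close> may be replaced by \<open>m_i |V|^2 / 2\<close> in \<open>\<langle>P, dn/dt\<rangle>\<close>,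
  and what remains is \<open>dH/dt\<close>.

  One term does not cancel algebraically: testing the pressure equation with 1 leaves the facet
  integral of \<open>[[V]] p~\<close>.  It vanishes because a cell-wise smooth field with a square-integrable
  weak divergence has continuous normal component (\<open>normal_jump_eq_0\<close>).  The argument is local
  and uses no surface integrals.  If \<open>u1\<close>, \<open>u2\<close> are the smooth extensions of the
  field from both sides, the weak divergence coincides in each cell with the classical one
  (\<open>weak_divergence_localize\<close>).  Subtracting the integration by parts for \<open>u1\<close> on a full ball
  shows that the field \<open>w = u2 - u1\<close>, restricted to one side \<open>L\<close> of the facet, satisfies
  \<open>\<integral>_L div (\<psi> w) = 0\<close> for all test functions \<open>\<psi>\<close> (\<open>flux_balance\<close>).  If \<open>w\<close> had a normal
  component at a facet point, a bump \<open>\<psi>\<close> centred slightly beyond the facet, of which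
  only a tiny cap reaches into \<open>L\<close>, would make the integrand negative (\<open>one_sided_flux_nonpos\<close>).

  The derivative of \<open>H\<close> is computed by separation of variables: finitely many point samples
  determine the elements of a finite-dimensional function space
  (\<open>sampling_representation\<close>), so pointwise differentiability in time yields differentiable
  coefficients, and the energy is a polynomial in them (\<open>separable_derivative\<close>).
\<close>

section \<open>Smooth bump functions\<close>

lemma Ck_on_antimono: "Ck_on (Suc k) U f \<Longrightarrow> Ck_on k U f"
proof (induction k arbitrary: f)
  case 0
  then show ?case by (simp add: differentiable_imp_continuous_on)
next
  case (Suc k)
  then show ?case by (metis Ck_on.simps(2))
qed

lemma pd_eqI:
  assumes "(f has_derivative f') (at x)"
  shows "pd i f x = f' (axis i 1)"
  using frechet_derivative_at[OF assms] by (simp add: pd_def)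

lemma pd_mult:
  fixes f g :: "point \<Rightarrow> real"
  assumes "f differentiable (at x)" "g differentiable (at x)"
  shows "pd i (\<lambda>x. f x * g x) x = f x * pd i g x + pd i f x * g x"
proof -
  have "((\<lambda>x. f x * g x) has_derivative
     (\<lambda>h. f x * frechet_derivative g (at x) h + frechet_derivative f (at x) h * g x)) (at x)"
    using assms by (intro has_derivative_mult) (simp_all add: frechet_derivative_works)
  from pd_eqI[OF this] show ?thesis by (simp add: pd_def)
qed

lemma pd_add:
  assumes "f differentiable (at x)" "g differentiable (at x)"
  shows "pd i (\<lambda>x. f x + g x) x = pd i f x + pd i g x"
proof -
  have "((\<lambda>x. f x + g x) has_derivative
     (\<lambda>h. frechet_derivative f (at x) h + frechet_derivative g (at x) h)) (at x)"
    using assms by (intro has_derivative_add) (simp_all add: frechet_derivative_works)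
  from pd_eqI[OF this] show ?thesis by (simp add: pd_def)
qed

lemma pd_const: "pd i (\<lambda>x. c) x = 0"
  by (rule pd_eqI[of _ "\<lambda>h. 0"]) simp

lemma Ck_on_const: "Ck_on k U (\<lambda>x. c)"
proof (induction k arbitrary: c)
  case (Suc k)
  have "pd i (\<lambda>x. c) = (\<lambda>x. 0)" for i by (simp add: pd_const fun_eq_iff)
  then show ?case using Suc by simp
qed simp

lemma Ck_on_add:
  assumes "Ck_on k UNIV f" "Ck_on k UNIV g"
  shows "Ck_on k UNIV (\<lambda>x. f x + g x)"
  using assms
proof (induction k arbitrary: f g)
  case 0
  then show ?case by (simp add: continuous_on_add)
next
  case (Suc k)
  have d: "f differentiable (at x)" "g differentiable (at x)" for x
    using Suc.prems by (auto simp: differentiable_on_def)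
  have "pd i (\<lambda>x. f x + g x) = (\<lambda>x. pd i f x + pd i g x)" for i
    using pd_add[OF d] by (simp add: fun_eq_iff)
  then show ?case using Suc by (simp add: differentiable_on_def)
qed

lemma Ck_on_mult:
  fixes f g :: "point \<Rightarrow> real"
  assumes "Ck_on k UNIV f" "Ck_on k UNIV g"
  shows "Ck_on k UNIV (\<lambda>x. f x * g x)"
  using assms
proof (induction k arbitrary: f g)
  case 0
  then show ?case by (simp add: continuous_on_mult)
next
  case (Suc k)
  have d: "f differentiable (at x)" "g differentiable (at x)" for x
    using Suc.prems by (auto simp: differentiable_on_def)
  have "pd i (\<lambda>x. f x * g x) = (\<lambda>x. f x * pd i g x + pd i f x * g x)" for i
    using pd_mult[OF d] by (simp add: fun_eq_iff)
  moreover have "Ck_on k UNIV f" "Ck_on k UNIV g" using Suc.prems Ck_on_antimono by blast+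
  ultimately show ?case using Suc by (simp add: differentiable_on_def Ck_on_add)
qed

text \<open>The outer function is given together with all its derivatives \<open>h 0, h 1, ...\<close>, because the
  chain rule turns level \<open>j\<close> into a product containing level \<open>j + 1\<close>.\<close>

lemma Ck_on_compose:
  fixes f :: "point \<Rightarrow> real" and h :: "nat \<Rightarrow> real \<Rightarrow> real"
  assumes h: "\<And>j s. (h j has_real_derivative h (Suc j) s) (at s)"
  assumes "Ck_on k UNIV f"
  shows "Ck_on k UNIV (\<lambda>x. h j (f x))"
  using assms(2)
proof (induction k arbitrary: j)
  case 0
  have "continuous_on UNIV (h j)"
    using h by (meson DERIV_isCont continuous_at_imp_continuous_on)
  then show ?case using 0 by (simp add: continuous_on_compose2)
next
  case (Suc k)
  have fd: "(f has_derivative frechet_derivative f (at x)) (at x)" for x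
    using Suc.prems by (simp add: differentiable_on_def frechet_derivative_works)
  have d: "((\<lambda>x. h j (f x)) has_derivative (\<lambda>v. h (Suc j) (f x) * frechet_derivative f (at x) v)) (at x)" for x
    using has_derivative_compose[OF fd h[unfolded has_field_derivative_def]] by simp
  have "pd i (\<lambda>x. h j (f x)) = (\<lambda>x. h (Suc j) (f x) * pd i f x)" for i
    using pd_eqI[OF d] by (simp add: fun_eq_iff pd_def)
  moreover have "Ck_on k UNIV f" using Suc.prems Ck_on_antimono by blast
  moreover have "\<forall>i. Ck_on k UNIV (pd i f)" using Suc.prems by simp
  moreover have "(\<lambda>x. h j (f x)) differentiable_on UNIV"
    using d by (auto simp: differentiable_on_def differentiable_def)
  ultimately show ?case using Suc.IH by (simp add: Ck_on_mult)
qed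

text \<open>The functions \<open>P(1/s) exp(-1/s)\<close>, extended by 0 to \<open>s \<le> 0\<close>, are closed under
  differentiation; allowing an arbitrary polynomial \<open>P\<close> makes this a one-step induction.\<close>

definition flat :: "real poly \<Rightarrow> real \<Rightarrow> real" where
  "flat P s = (if s \<le> 0 then 0 else poly P (1 / s) * exp (- (1 / s)))"

lemma flat_tendsto_0: "(flat P \<longlongrightarrow> 0) (at_right 0)"
proof -
  have "((\<lambda>x. \<Sum>i\<le>degree P. coeff P i * (x ^ i / exp x)) \<longlongrightarrow> (\<Sum>i\<le>degree P. coeff P i * 0)) at_top"
    by (intro tendsto_sum tendsto_mult tendsto_const tendsto_power_div_exp_0)
  then have "((\<lambda>x. poly P x * exp (- x)) \<longlongrightarrow> 0) at_top"
    by (simp add: poly_altdef sum_distrib_right exp_minus divide_inverse mult.assoc)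
  then have "((\<lambda>x. poly P (inverse x) * exp (- inverse x)) \<longlongrightarrow> 0) (at_right (0::real))"
    using filterlim_compose filterlim_inverse_at_top_right by blast
  moreover have "\<forall>\<^sub>F s in at_right 0. poly P (inverse s) * exp (- inverse s) = flat P s"
    using eventually_at_right_less[of 0] by eventually_elim (simp add: flat_def divide_inverse)
  ultimately show ?thesis by (rule Lim_transform_eventually)
qed

lemma DERIV_flat:
  "(flat P has_real_derivative flat ([:0, 0, 1:] * (P - pderiv P)) s) (at s)"
proof (cases s "0::real" rule: linorder_cases)
  case less
  have "((\<lambda>s. 0) has_real_derivative 0) (at s)" by simp
  then have "(flat P has_real_derivative 0) (at s)"
    by (rule DERIV_cong_ev[THEN iffD1, rotated -1])
       (use less in \<open>auto simp: flat_def intro!: eventually_mono[OF eventually_nhds_in_open[of "{..<0}"]]\<close>)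
  then show ?thesis using less by (simp add: flat_def)
next
  case greater
  have "((\<lambda>s. poly P (1 / s) * exp (- (1 / s))) has_real_derivative
     poly ([:0, 0, 1:] * (P - pderiv P)) (1 / s) * exp (- (1 / s))) (at s)"
    using greater
    by (auto intro!: derivative_eq_intros DERIV_chain2[OF poly_DERIV] simp: field_simps power2_eq_square)
  then have "(flat P has_real_derivative poly ([:0, 0, 1:] * (P - pderiv P)) (1 / s) * exp (- (1 / s))) (at s)"
    by (rule DERIV_cong_ev[THEN iffD1, rotated -1])
       (use greater in \<open>auto simp: flat_def intro!: eventually_mono[OF eventually_nhds_in_open[of "{0<..}"]]\<close>)
  then show ?thesis using greater by (simp add: flat_def)
next
  case equal
  have "((\<lambda>h. flat P h / h) \<longlongrightarrow> 0) (at_right 0)"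
  proof (rule Lim_transform_eventually[OF flat_tendsto_0[of "[:0,1:] * P"]])
    show "\<forall>\<^sub>F s in at_right 0. flat ([:0, 1:] * P) s = flat P s / s"
      using eventually_at_right_less[of 0] by eventually_elim (simp add: flat_def)
  qed
  moreover have "((\<lambda>h. flat P h / h) \<longlongrightarrow> 0) (at_left 0)"
  proof (rule Lim_transform_eventually[OF tendsto_const])
    show "\<forall>\<^sub>F s in at_left 0. 0 = flat P s / s"
      by (simp add: eventually_at_filter flat_def)
  qed
  ultimately have "((\<lambda>h. flat P h / h) \<longlongrightarrow> 0) (at 0)" by (simp add: filterlim_split_at)
  then show ?thesis using equal by (simp add: DERIV_def flat_def)
qed

definition bump :: "point \<Rightarrow> real \<Rightarrow> point \<Rightarrow> real" where
  "bump c r x = flat 1 (r\<^sup>2 - (norm (x - c))\<^sup>2)"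

lemma Ck_on_component: "Ck_on k UNIV (\<lambda>x::point. x $ i)"
proof (cases k)
  case (Suc m)
  have d: "((\<lambda>x::point. x $ i) has_derivative (\<lambda>h. h $ i)) (at x)" for x
    by (intro bounded_linear_imp_has_derivative bounded_linear_vec_nth)
  have "pd j (\<lambda>x::point. x $ i) = (\<lambda>x. axis j 1 $ i)" for j
    using pd_eqI[OF d] by (simp add: fun_eq_iff)
  then show ?thesis using Suc d
    by (auto simp: Ck_on_const differentiable_on_def differentiable_def)
qed (simp add: continuous_on_component)

lemma smooth_on_bump: "smooth_on UNIV (bump c r)"
  unfolding smooth_on_def
proof
  fix k
  have "Ck_on k UNIV (\<lambda>x::point. (x $ i + - c $ i) * (x $ i + - c $ i))" for i
    by (intro Ck_on_mult Ck_on_add Ck_on_component Ck_on_const)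
  note q = this
  have "Ck_on k UNIV (\<lambda>x::point. r\<^sup>2 + (-1) * ((x $ 1 + - c $ 1) * (x $ 1 + - c $ 1)
     + (x $ 2 + - c $ 2) * (x $ 2 + - c $ 2) + (x $ 3 + - c $ 3) * (x $ 3 + - c $ 3)))" (is "Ck_on k UNIV ?q")
    by (intro Ck_on_mult Ck_on_add Ck_on_component Ck_on_const)
  moreover have "?q = (\<lambda>x. r\<^sup>2 - (norm (x - c))\<^sup>2)"
    by (simp add: fun_eq_iff power2_norm_eq_inner inner_vec_def sum_3)
  ultimately have *: "Ck_on k UNIV (\<lambda>x. r\<^sup>2 - (norm (x - c))\<^sup>2)" by simp
  define h where "h j = flat (((\<lambda>P. [:0, 0, 1:] * (P - pderiv P)) ^^ j) 1)" for j
  have "(h j has_real_derivative h (Suc j) s) (at s)" for j s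
    unfolding h_def using DERIV_flat by simp
  from Ck_on_compose[of h, OF this *, of 0] show "Ck_on k UNIV (bump c r)"
    by (simp add: h_def bump_def[abs_def])
qed

section \<open>Partial derivatives and integration by parts\<close>

lemma pd_zero_outside:
  assumes "closed C" "\<And>x. x \<notin> C \<Longrightarrow> f x = 0" "x \<notin> C"
  shows "(f has_derivative (\<lambda>h. 0)) (at x)" "pd i f x = 0"
proof -
  show "(f has_derivative (\<lambda>h. 0)) (at x)"
    by (rule has_derivative_transform_within_open[of "\<lambda>x. 0" _ _ UNIV "- C"]) (use assms in auto)
  from pd_eqI[OF this] show "pd i f x = 0" .
qed

lemma DERIV_line:
  fixes f :: "point \<Rightarrow> real"
  assumes "f differentiable (at (x + t *\<^sub>R axis i 1))"
  shows "((\<lambda>t. f (x + t *\<^sub>R axis i 1)) has_real_derivative pd i f (x + t *\<^sub>R axis i 1)) (at t)"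
proof -
  let ?D = "frechet_derivative f (at (x + t *\<^sub>R axis i 1))"
  have fd: "(f has_derivative ?D) (at (x + t *\<^sub>R axis i 1))"
    using assms by (simp add: frechet_derivative_works)
  have "((\<lambda>t. x + t *\<^sub>R axis i 1) has_derivative (\<lambda>h. h *\<^sub>R axis i 1)) (at t)"
    by (auto intro!: derivative_eq_intros)
  from has_derivative_compose[OF this fd]
  have "((\<lambda>t. f (x + t *\<^sub>R axis i 1)) has_derivative (\<lambda>h. ?D (h *\<^sub>R axis i 1))) (at t)" .
  moreover have "?D (h *\<^sub>R axis i 1) = pd i f (x + t *\<^sub>R axis i 1) * h" for h
    using linear_scale[OF has_derivative_linear[OF fd]] by (simp add: pd_def)
  ultimately show ?thesis by (simp add: has_field_derivative_def)
qed

lemma integrable_continuous_compact_support: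
  fixes f :: "point \<Rightarrow> real"
  assumes "continuous_on UNIV f" "compact C" "\<And>x. x \<notin> C \<Longrightarrow> f x = 0"
  shows "integrable lebesgue f" "integrable lborel f"
proof -
  have "set_integrable lborel C f"
    unfolding set_integrable_def
    using borel_integrable_compact[OF assms(2) continuous_on_subset[OF assms(1) subset_UNIV]]
    by (simp add: indicator_def of_bool_def if_distrib cong: if_cong)
  moreover have "(\<lambda>x. indicator C x *\<^sub>R f x) = f" using assms(3) by (auto simp: indicator_def fun_eq_iff)
  ultimately show "integrable lborel f" by (simp add: set_integrable_def)
  then show "integrable lebesgue f"
    using integrable_completion[of f lborel] borel_measurable_integrable by blast
qed

text \<open>Translation invariance makes the integral of every difference quotient zero; the quotients
  are bounded by the supremum of the derivative, so dominated convergence applies.\<close>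

lemma integral_pd_eq_0:
  fixes f :: "point \<Rightarrow> real"
  assumes d: "\<And>x. f differentiable (at x)" and c: "continuous_on UNIV (pd i f)"
    and C: "compact C" and z: "\<And>x. x \<notin> C \<Longrightarrow> f x = 0"
  shows "integral\<^sup>L lebesgue (pd i f) = 0"
proof -
  let ?e = "axis i 1 :: point"
  have fc: "continuous_on UNIV f"
    using d by (simp add: continuous_on_eq_continuous_at differentiable_imp_continuous_within)
  have pz: "pd i f x = 0" if "x \<notin> C" for x
    using pd_zero_outside(2)[of C f x i] compact_imp_closed[OF C] z that by blast
  obtain B where B: "\<And>x. \<bar>pd i f x\<bar> \<le> B" "B \<ge> 0"
  proof -
    have "bounded (pd i f ` C)"
      using compact_imp_bounded[OF compact_continuous_image[OF continuous_on_subset[OF c] C]] by auto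
    then obtain b where "b > 0" "\<And>x. x \<in> C \<Longrightarrow> \<bar>pd i f x\<bar> \<le> b"
      by (auto simp: bounded_pos)
    then show ?thesis using pz by (intro that[of b]) (metis abs_zero less_imp_le, simp)
  qed
  obtain R where R: "\<And>x. x \<in> C \<Longrightarrow> norm x \<le> R"
    using compact_imp_bounded[OF C] by (auto simp: bounded_iff)
  define h where "h m = inverse (real (Suc m))" for m
  have hp: "h m > 0" "h m \<le> 1" for m by (auto simp: h_def inverse_le_1_iff)
  have hl: "h \<longlonglongrightarrow> 0" unfolding h_def by (rule LIMSEQ_inverse_real_of_nat)
  define q where "q m x = (f (x + h m *\<^sub>R ?e) - f x) / h m" for m x
  have fm: "f \<in> borel_measurable borel" using fc by (rule borel_measurable_continuous_onI)
  have fsc: "continuous_on UNIV (\<lambda>x. f (x + v))" for v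
    by (intro continuous_on_compose2[OF fc] continuous_intros) auto
  have fi: "integrable lborel f" by (rule integrable_continuous_compact_support(2)[OF fc C z])
  have fs: "has_bochner_integral lborel (\<lambda>x. f (x + v)) (integral\<^sup>L lborel f)" for v
  proof -
    have m: "(+) v \<in> measurable lborel borel" by simp
    have "has_bochner_integral lborel (\<lambda>x. f (v + x)) (integral\<^sup>L lborel f)"
      using integrable_distr_eq[OF m fm] integral_distr[OF m fm] fi
      by (simp add: lborel_distr_plus has_bochner_integral_iff)
    then show ?thesis by (simp add: add.commute)
  qed
  have q0: "integral\<^sup>L lborel (q m) = 0" for m
    using fs[of "h m *\<^sub>R ?e"] fi unfolding q_def has_bochner_integral_iff by simp
  have "(\<lambda>m. integral\<^sup>L lborel (q m)) \<longlonglongrightarrow> integral\<^sup>L lborel (pd i f)"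
  proof (rule integral_dominated_convergence)
    show "pd i f \<in> borel_measurable lborel" using borel_measurable_continuous_onI[OF c] by simp
    have "continuous_on UNIV (q m)" for m
      unfolding q_def using hp[of m] by (intro continuous_intros fsc fc) auto
    then show "q m \<in> borel_measurable lborel" for m
      using borel_measurable_continuous_onI by auto
    \<comment> \<open>Radius \<open>R + 1\<close> covers the supports of all difference quotients, as \<open>h m \<le> 1\<close>.\<close>
    show "integrable lborel (\<lambda>x::point. indicator (cball 0 (R + 1)) x *\<^sub>R B)"
      using borel_integrable_compact[of "cball 0 (R+1)" "\<lambda>x::point. B"]
      by (simp add: indicator_def of_bool_def if_distrib cong: if_cong)
    show "AE x in lborel. (\<lambda>m. q m x) \<longlonglongrightarrow> pd i f x"
    proof (rule AE_I2)
      fix x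
      have "((\<lambda>t. (f (x + t *\<^sub>R ?e) - f x) / t) \<longlongrightarrow> pd i f x) (at 0)"
        using DERIV_line[of f x 0 i] d by (simp add: DERIV_def)
      moreover have "filterlim h (at 0) sequentially"
        using hl hp(1) by (simp add: filterlim_at less_imp_neq[symmetric])
      ultimately show "(\<lambda>m. q m x) \<longlonglongrightarrow> pd i f x"
        unfolding q_def by (rule filterlim_compose)
    qed
    show "AE x in lborel. norm (q m x) \<le> indicator (cball 0 (R + 1)) x *\<^sub>R B" for m
    proof (rule AE_I2)
      fix x
      show "norm (q m x) \<le> indicator (cball 0 (R + 1)) x *\<^sub>R B"
      proof (cases "x \<in> cball 0 (R+1)")
        case True
        obtain z where "f (x + h m *\<^sub>R ?e) - f (x + 0 *\<^sub>R ?e) = (h m - 0) * pd i f (x + z *\<^sub>R ?e)"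
          using MVT2[of 0 "h m" "\<lambda>t. f (x + t *\<^sub>R ?e)" "\<lambda>t. pd i f (x + t *\<^sub>R ?e)"] hp d DERIV_line by blast
        then have "q m x = pd i f (x + z *\<^sub>R ?e)" using hp(1)[of m] by (simp add: q_def)
        then show ?thesis using True B by simp
      next
        case False
        have "x \<notin> C" using False R by force
        moreover have "x + h m *\<^sub>R ?e \<notin> C"
        proof
          assume "x + h m *\<^sub>R ?e \<in> C"
          then have "norm (x + h m *\<^sub>R ?e) \<le> R" by (rule R)
          moreover have "norm x \<le> norm (x + h m *\<^sub>R ?e) + norm (h m *\<^sub>R ?e)"
            by (metis add_diff_cancel norm_triangle_ineq4)
          moreover have "norm (h m *\<^sub>R ?e) \<le> 1" using hp[of m] by (simp add: norm_axis_1)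
          ultimately show False using False by simp
        qed
        ultimately have "q m x = 0" using \<open>x \<notin> C\<close> z by (simp add: q_def)
        then show ?thesis using B(2) by simp
      qed
    qed
  qed
  then have "integral\<^sup>L lborel (pd i f) = 0"
    using LIMSEQ_unique[OF _ tendsto_const[of 0]] by (simp add: q0)
  then show ?thesis
    using integral_completion[of "pd i f" lborel] borel_measurable_continuous_onI[OF c] by simp
qed

text \<open>Extensions of fields across a facet are used only through their first derivatives, which
  are easier to transport along translations than smoothness of all orders.\<close>

definition C1_on :: "point set \<Rightarrow> (point \<Rightarrow> 'b::real_normed_vector) \<Rightarrow> bool" where
  "C1_on U f \<longleftrightarrow> (\<forall>x\<in>U. f differentiable (at x)) \<and> (\<forall>i. continuous_on U (pd i f))"

lemma C1_on_continuous: "C1_on U f \<Longrightarrow> continuous_on U f"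
  by (simp add: C1_on_def continuous_at_imp_continuous_on differentiable_imp_continuous_within)

lemma C1_on_subset: "C1_on U f \<Longrightarrow> W \<subseteq> U \<Longrightarrow> C1_on W f"
  by (auto simp: C1_on_def intro: continuous_on_subset)

lemma C1_on_smooth: "open U \<Longrightarrow> smooth_on U f \<Longrightarrow> C1_on U f"
proof -
  assume U: "open U" and s: "smooth_on U f"
  have "Ck_on (Suc 0) U f" using s by (simp add: smooth_on_def del: Ck_on.simps)
  then have "f differentiable_on U" "\<And>i. continuous_on U (pd i f)" by simp_all
  then show ?thesis using differentiable_on_eq_differentiable_at[OF U] unfolding C1_on_def by blast
qed

lemma pd_component:
  fixes u :: "point \<Rightarrow> point"
  assumes "u differentiable (at x)"
  shows "pd i (\<lambda>x. u x $ j) x = pd i u x $ j"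
proof -
  have "((\<lambda>x. u x $ j) has_derivative (\<lambda>h. frechet_derivative u (at x) h $ j)) (at x)"
    by (rule bounded_linear.has_derivative[OF bounded_linear_vec_nth])
       (use assms in \<open>simp add: frechet_derivative_works\<close>)
  from pd_eqI[OF this] show ?thesis by (simp add: pd_def)
qed

lemma component_differentiable:
  fixes u :: "point \<Rightarrow> point"
  assumes "u differentiable (at x)"
  shows "(\<lambda>x. u x $ j) differentiable (at x)"
  using assms bounded_linear.has_derivative[OF bounded_linear_vec_nth] unfolding differentiable_def by blast

lemma C1_on_component: 
  fixes u :: "point \<Rightarrow> point"
  assumes "C1_on U u" shows "C1_on U (\<lambda>x. u x $ j)"
proof -
  have "continuous_on U (pd i (\<lambda>x. u x $ j))" for i
  proof (subst continuous_on_cong[OF refl])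
    show "pd i (\<lambda>x. u x $ j) x = pd i u x $ j" if "x \<in> U" for x
      using assms that by (auto simp: C1_on_def intro!: pd_component)
    show "continuous_on U (\<lambda>x. pd i u x $ j)"
      using assms by (auto simp: C1_on_def intro!: continuous_on_component)
  qed
  then show ?thesis using assms by (auto simp: C1_on_def component_differentiable)
qed

lemma C1_on_mult:
  fixes f g :: "point \<Rightarrow> real"
  assumes "C1_on U f" "C1_on U g" shows "C1_on U (\<lambda>x. f x * g x)"
proof -
  have "continuous_on U (pd i (\<lambda>x. f x * g x))" for i
  proof (subst continuous_on_cong[OF refl])
    show "pd i (\<lambda>x. f x * g x) x = f x * pd i g x + pd i f x * g x" if "x \<in> U" for x
      using assms that by (auto simp: C1_on_def intro!: pd_mult)
    show "continuous_on U (\<lambda>x. f x * pd i g x + pd i f x * g x)"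
      using assms C1_on_continuous[OF assms(1)] C1_on_continuous[OF assms(2)]
      by (auto simp: C1_on_def intro!: continuous_intros)
  qed
  then show ?thesis using assms by (auto simp: C1_on_def differentiable_mult)
qed

lemma C1_on_divergence: "C1_on U u \<Longrightarrow> continuous_on U (divergence u)"
  unfolding divergence_def[abs_def] C1_on_def by (intro continuous_on_sum continuous_on_component) simp

lemma C1_on_grad: "C1_on U f \<Longrightarrow> continuous_on U (grad f)"
  unfolding grad_def[abs_def] C1_on_def by (intro continuous_on_vec_lambda) simp

text \<open>Fields defined only near a facet can be integrated by parts after multiplication by a
  test function, since the product is differentiable everywhere once it is extended by 0.\<close>

lemma integral_pd_eq_0_local:
  fixes f :: "point \<Rightarrow> real"
  assumes U: "open U" and f: "C1_on U f"
    and C: "compact C" "C \<subseteq> U" and z: "\<And>x. x \<notin> C \<Longrightarrow> f x = 0"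
  shows "integrable lebesgue (pd i f)" "integral\<^sup>L lebesgue (pd i f) = 0"
proof -
  note zo = pd_zero_outside[of C f, OF compact_imp_closed[OF C(1)] z]
  have d: "f differentiable (at x)" for x
    using f C(2) zo(1)[of x] by (cases "x \<in> C") (auto simp: C1_on_def differentiable_def)
  have "continuous_on (U \<union> - C) (pd i f)"
  proof (rule continuous_on_open_Un[OF U])
    show "open (- C)" using compact_imp_closed[OF C(1)] by auto
    show "continuous_on U (pd i f)" using f by (simp add: C1_on_def)
    show "continuous_on (- C) (pd i f)"
      by (subst continuous_on_cong[OF refl, of _ _ "\<lambda>x. 0"]) (use zo(2) in auto)
  qed
  moreover have "U \<union> - C = UNIV" using C(2) by auto
  ultimately have c: "continuous_on UNIV (pd i f)" by simp
  show "integral\<^sup>L lebesgue (pd i f) = 0" by (rule integral_pd_eq_0[OF d c C(1) z])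
  show "integrable lebesgue (pd i f)"
    by (rule integrable_continuous_compact_support(1)[OF c C(1)]) (rule zo(2))
qed

lemma integral_by_parts:
  fixes u :: "point \<Rightarrow> point" and \<phi> :: "point \<Rightarrow> real"
  assumes U: "open U" and u: "C1_on U u" and p: "C1_on U \<phi>"
    and C: "compact C" "C \<subseteq> U" and z: "\<And>x. x \<notin> C \<Longrightarrow> \<phi> x = 0"
  shows "integral\<^sup>L lebesgue (\<lambda>x. u x \<bullet> grad \<phi> x + divergence u x * \<phi> x) = 0"
proof -
  have c: "C1_on U (\<lambda>x. u x $ i * \<phi> x)" for i by (intro C1_on_mult C1_on_component u p)
  have z': "u x $ i * \<phi> x = 0" if "x \<notin> C" for x i using z[OF that] by simp
  note I = integral_pd_eq_0_local[OF U c C z']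
  have "u x \<bullet> grad \<phi> x + divergence u x * \<phi> x = (\<Sum>i\<in>UNIV. pd i (\<lambda>x. u x $ i * \<phi> x) x)" for x
  proof (cases "x \<in> U")
    case True
    have "pd i (\<lambda>x. u x $ i * \<phi> x) x = u x $ i * pd i \<phi> x + pd i u x $ i * \<phi> x" for i
      using True u p by (simp add: pd_mult C1_on_def component_differentiable pd_component)
    then show ?thesis
      by (simp add: inner_vec_def grad_def divergence_def sum.distrib sum_distrib_right)
  next
    case False
    then have "x \<notin> C" using C(2) by auto
    then have "pd i \<phi> x = 0" "\<phi> x = 0" "pd i (\<lambda>x. u x $ i * \<phi> x) x = 0" for i
      using pd_zero_outside(2)[OF compact_imp_closed[OF C(1)] z'] z
        pd_zero_outside(2)[OF compact_imp_closed[OF C(1)] z] by auto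
    then show ?thesis by (simp add: inner_vec_def grad_def)
  qed
  then show ?thesis using I by simp
qed

section \<open>Smooth cutoffs and test functions\<close>

lemma bump_pos_iff:
  assumes "r > 0" shows "bump c r x > 0 \<longleftrightarrow> x \<in> ball c r"
proof -
  have "x \<in> ball c r \<longleftrightarrow> (norm (x - c))\<^sup>2 < r\<^sup>2"
    using assms by (simp add: dist_norm norm_minus_commute abs_le_square_iff[symmetric] not_le[symmetric])
  then show ?thesis by (simp add: bump_def flat_def)
qed

lemma bump_nonneg: "bump c r x \<ge> 0"
  by (simp add: bump_def flat_def)

lemma bump_le_1: "bump c r x \<le> 1"
  by (simp add: bump_def flat_def)

lemma bump_eq_0:
  assumes "r > 0" "x \<notin> cball c r" shows "bump c r x = 0"
  using bump_pos_iff[OF assms(1), of c x] bump_nonneg[of c r x] assms(2) by auto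

lemma smooth_on_const: "smooth_on U (\<lambda>x. c)"
  by (simp add: smooth_on_def Ck_on_const)

lemma smooth_on_add: "smooth_on UNIV f \<Longrightarrow> smooth_on UNIV g \<Longrightarrow> smooth_on UNIV (\<lambda>x. f x + g x)"
  by (simp add: smooth_on_def Ck_on_add)

lemma smooth_on_mult:
  fixes f g :: "point \<Rightarrow> real"
  shows "smooth_on UNIV f \<Longrightarrow> smooth_on UNIV g \<Longrightarrow> smooth_on UNIV (\<lambda>x. f x * g x)"
  by (simp add: smooth_on_def Ck_on_mult)

lemma smooth_on_prod:
  fixes f :: "nat \<Rightarrow> point \<Rightarrow> real"
  assumes "\<And>i. smooth_on UNIV (f i)"
  shows "smooth_on UNIV (\<lambda>x. \<Prod>i<m. f i x)"
  by (induction m) (simp_all add: smooth_on_const smooth_on_mult assms)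

lemma smooth_on_power:
  fixes f :: "point \<Rightarrow> real"
  assumes "smooth_on UNIV f"
  shows "smooth_on UNIV (\<lambda>x. f x ^ m)"
  by (induction m) (simp_all add: smooth_on_const smooth_on_mult assms)

lemma smooth_on_continuous: "smooth_on U f \<Longrightarrow> continuous_on U f"
  unfolding smooth_on_def using Ck_on.simps(1) by blast

lemma bump_cover:
  assumes U: "open U" "U \<noteq> {}"
  obtains c :: "nat \<Rightarrow> point" and r :: "nat \<Rightarrow> real"
  where "\<And>i. r i > 0" "\<And>i. cball (c i) (r i) \<subseteq> U" "U \<subseteq> (\<Union>i. ball (c i) (r i))"
proof -
  define \<F> where "\<F> = {ball c r | c r. r > 0 \<and> cball c r \<subseteq> U}"
  have "\<Union>\<F> = U"
  proof
    show "U \<subseteq> \<Union>\<F>"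
    proof
      fix x assume "x \<in> U"
      then obtain r where "r > 0" "cball x r \<subseteq> U" using U open_contains_cball by blast
      then have "ball x r \<in> \<F>" "x \<in> ball x r" by (auto simp: \<F>_def)
      then show "x \<in> \<Union>\<F>" by blast
    qed
  qed (auto simp: \<F>_def)
  obtain \<G> where G: "\<G> \<subseteq> \<F>" "countable \<G>" "\<Union>\<G> = \<Union>\<F>"
    using Lindelof[of \<F>] by (auto simp: \<F>_def)
  have ne: "\<G> \<noteq> {}" using G(3) \<open>\<Union>\<F> = U\<close> U by auto
  have "\<exists>c r. from_nat_into \<G> i = ball c r \<and> r > 0 \<and> cball c r \<subseteq> U" for i
    using from_nat_into[OF ne, of i] G(1) by (auto simp: \<F>_def)
  then obtain c r where cr: "\<And>i. from_nat_into \<G> i = ball (c i) (r i)" "\<And>i. r i > 0"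
      "\<And>i. cball (c i) (r i) \<subseteq> U" by metis
  have "U \<subseteq> (\<Union>i. ball (c i) (r i))"
    using \<open>\<Union>\<F> = U\<close> G(3) range_from_nat_into[OF ne G(2)] by (simp add: cr(1)[symmetric])
  with cr show ?thesis by (intro that) auto
qed

text \<open>Cover \<open>U\<close> by countably many balls with bumps \<open>\<beta>_i \<le> 1\<close> and take
  \<open>1 - (\<Prod>i<m. 1 - \<beta>_i)^m\<close>.  The cutoffs serve dominated convergence, which
  asks for boundedness and pointwise convergence but tolerates exploding gradients.\<close>

lemma smooth_cutoffs:
  assumes U: "open U"
  obtains \<eta> :: "nat \<Rightarrow> point \<Rightarrow> real" where
    "\<And>m. test_function U (\<eta> m)" "\<And>m x. 0 \<le> \<eta> m x" "\<And>m x. \<eta> m x \<le> 1"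
    "\<And>x. x \<in> U \<Longrightarrow> (\<lambda>m. \<eta> m x) \<longlonglongrightarrow> 1"
proof (cases "U = {}")
  case True
  show ?thesis
    by (rule that[of "\<lambda>m x. 0"]) (use True in \<open>auto simp: test_function_def smooth_on_const intro!: exI[of _ "{}"]\<close>)
next
  case False
  obtain c :: "nat \<Rightarrow> point" and r :: "nat \<Rightarrow> real"
    where cr: "\<And>i. r i > 0" "\<And>i. cball (c i) (r i) \<subseteq> U" "U \<subseteq> (\<Union>i. ball (c i) (r i))"
    by (rule bump_cover[OF U False]) (rule that)
  define b where "b i x = 1 - bump (c i) (r i) x" for i x
  have b01: "0 \<le> b i x" "b i x \<le> 1" for i x using bump_nonneg bump_le_1 by (auto simp: b_def)
  \<comment> \<open>The outer power forces convergence to 1 although each bump may be far below 1.\<close>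
  define \<eta> where "\<eta> m x = 1 - (\<Prod>i<m. b i x) ^ m" for m x
  have p01: "0 \<le> (\<Prod>i<m. b i x)" "(\<Prod>i<m. b i x) \<le> 1" for m x
    using b01 by (auto intro: prod_nonneg prod_le_1)
  show ?thesis
  proof (rule that[of \<eta>])
    show "0 \<le> \<eta> m x" "\<eta> m x \<le> 1" for m x
      using p01 by (auto simp: \<eta>_def power_le_one)
    show "test_function U (\<eta> m)" for m
    proof -
      have sb: "smooth_on UNIV (b i)" for i
        using smooth_on_add[OF smooth_on_const[of UNIV 1] smooth_on_mult[OF smooth_on_const[of UNIV "-1"] smooth_on_bump[of "c i" "r i"]]]
        by (simp add: b_def[abs_def])
      have "smooth_on UNIV (\<eta> m)"
        using smooth_on_add[OF smooth_on_const[of UNIV 1] smooth_on_mult[OF smooth_on_const[of UNIV "-1"]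
              smooth_on_power[OF smooth_on_prod[of b, OF sb], of m m]]]
        by (simp add: \<eta>_def[abs_def])
      moreover have "\<eta> m x = 0" if "x \<notin> (\<Union>i<m. cball (c i) (r i))" for x
      proof -
        have "b i x = 1" if "i < m" for i
          using bump_eq_0[OF cr(1)[of i], of x "c i"] \<open>x \<notin> _\<close> that by (auto simp: b_def)
        then show ?thesis by (simp add: \<eta>_def)
      qed
      moreover have "compact (\<Union>i<m. cball (c i) (r i))" by (intro compact_UN) auto
      moreover have "(\<Union>i<m. cball (c i) (r i)) \<subseteq> U" using cr(2) by blast
      ultimately show ?thesis unfolding test_function_def by blast
    qed
    show "(\<lambda>m. \<eta> m x) \<longlonglongrightarrow> 1" if "x \<in> U" for x
    proof -
      obtain k where k: "x \<in> ball (c k) (r k)" using \<open>x \<in> U\<close> cr(3) by blast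
      have bk: "0 \<le> b k x" "b k x < 1" using bump_pos_iff[OF cr(1)] k b01 by (auto simp: b_def)
      have "(\<lambda>m. (\<Prod>i<m. b i x) ^ m) \<longlonglongrightarrow> 0"
      proof (rule tendsto_sandwich[OF _ _ tendsto_const])
        show "(\<lambda>m. b k x ^ m) \<longlonglongrightarrow> 0" using bk by (intro LIMSEQ_power_zero) auto
        show "\<forall>\<^sub>F m in sequentially. 0 \<le> (\<Prod>i<m. b i x) ^ m" using p01 by simp
        show "\<forall>\<^sub>F m in sequentially. (\<Prod>i<m. b i x) ^ m \<le> b k x ^ m"
          using eventually_gt_at_top[of k]
        proof eventually_elim
          case (elim m)
          have "(\<Prod>i<m. b i x) = b k x * (\<Prod>i\<in>{..<m} - {k}. b i x)"
            using elim by (intro prod.remove) auto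
          also have "\<dots> \<le> b k x * 1"
            using b01 bk by (intro mult_left_mono prod_le_1) auto
          finally show ?case using p01 by (intro power_mono) auto
        qed
      qed
      from tendsto_diff[OF tendsto_const[of 1] this] show ?thesis by (simp add: \<eta>_def)
    qed
  qed
qed

lemma lebesgue_measurable_continuous:
  fixes f :: "point \<Rightarrow> real"
  shows "continuous_on UNIV f \<Longrightarrow> f \<in> borel_measurable lebesgue"
  using borel_measurable_continuous_onI[of f] by (simp add: measurable_completion)

text \<open>A substitute for the fundamental lemma of the calculus of variations: orthogonality to the
  test functions of \<open>U\<close> passes to smooth functions that do not vanish near the boundary of
  \<open>U\<close>, by multiplying with cutoffs.  Here it is applied with \<open>U\<close> one side of a facet.\<close>

lemma integral_test_functions_extend:
  fixes g \<psi> :: "point \<Rightarrow> real"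
  assumes U: "open U" and g: "integrable lebesgue g"
    and orth: "\<And>\<phi>. test_function U \<phi> \<Longrightarrow> integral\<^sup>L lebesgue (\<lambda>x. g x * \<phi> x) = 0"
    and \<psi>: "smooth_on UNIV \<psi>" "\<And>x. \<bar>\<psi> x\<bar> \<le> B" and g0: "\<And>x. x \<notin> U \<Longrightarrow> g x = 0"
  shows "integral\<^sup>L lebesgue (\<lambda>x. g x * \<psi> x) = 0"
proof -
  obtain \<eta> :: "nat \<Rightarrow> point \<Rightarrow> real" where \<eta>: "\<And>m. test_function U (\<eta> m)" "\<And>m x. 0 \<le> \<eta> m x" "\<And>m x. \<eta> m x \<le> 1"
    "\<And>x. x \<in> U \<Longrightarrow> (\<lambda>m. \<eta> m x) \<longlonglongrightarrow> 1"
    by (rule smooth_cutoffs[OF U]) (rule that)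
  have cont: "continuous_on UNIV \<psi>" "continuous_on UNIV (\<eta> m)" for m
    using \<psi>(1) \<eta>(1)[unfolded test_function_def] smooth_on_continuous by blast+
  have t: "test_function U (\<lambda>x. \<psi> x * \<eta> m x)" for m
  proof -
    obtain C where C: "compact C" "C \<subseteq> U" "\<And>x. x \<notin> C \<Longrightarrow> \<eta> m x = 0"
      using \<eta>(1)[of m] unfolding test_function_def by blast
    have "smooth_on UNIV (\<eta> m)" using \<eta>(1)[of m] unfolding test_function_def by blast
    from smooth_on_mult[OF \<psi>(1) this] show ?thesis
      unfolding test_function_def using C by (intro conjI exI[of _ C]) auto
  qed
  have "(\<lambda>m. integral\<^sup>L lebesgue (\<lambda>x. g x * (\<psi> x * \<eta> m x))) \<longlonglongrightarrow> integral\<^sup>L lebesgue (\<lambda>x. g x * \<psi> x)"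
  proof (rule integral_dominated_convergence)
    have gm: "g \<in> borel_measurable lebesgue" using g by blast
    show "(\<lambda>x. g x * \<psi> x) \<in> borel_measurable lebesgue"
      by (intro borel_measurable_times gm lebesgue_measurable_continuous cont)
    show "(\<lambda>x. g x * (\<psi> x * \<eta> m x)) \<in> borel_measurable lebesgue" for m
      by (intro borel_measurable_times gm lebesgue_measurable_continuous cont)
    show "integrable lebesgue (\<lambda>x. \<bar>g x\<bar> * B)"
      using g by (intro integrable_mult_left integrable_abs)
    show "AE x in lebesgue. (\<lambda>m. g x * (\<psi> x * \<eta> m x)) \<longlonglongrightarrow> g x * \<psi> x"
    proof (rule AE_I2)
      fix x
      show "(\<lambda>m. g x * (\<psi> x * \<eta> m x)) \<longlonglongrightarrow> g x * \<psi> x"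
      proof (cases "x \<in> U")
        case True
        have "(\<lambda>m. g x * (\<psi> x * \<eta> m x)) \<longlonglongrightarrow> g x * (\<psi> x * 1)"
          by (intro tendsto_intros \<eta>(4) True)
        then show ?thesis by simp
      qed (simp add: g0)
    qed
    show "AE x in lebesgue. norm (g x * (\<psi> x * \<eta> m x)) \<le> \<bar>g x\<bar> * B" for m
    proof (rule AE_I2)
      fix x
      have "\<bar>\<psi> x\<bar> * \<eta> m x \<le> B * 1"
        using \<psi>(2)[of x] \<eta>(2,3)[of m x] by (intro mult_mono) auto
      then show "norm (g x * (\<psi> x * \<eta> m x)) \<le> \<bar>g x\<bar> * B"
        using \<eta>(2)[of m x] by (simp add: abs_mult mult_left_mono)
    qed
  qed
  then show ?thesis
    using LIMSEQ_unique[OF _ tendsto_const[of 0]] by (simp add: orth[OF t])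
qed

lemma grad_bump:
  "grad (bump c r) x = (- 2 * flat [:0, 0, 1:] (r\<^sup>2 - (norm (x - c))\<^sup>2)) *\<^sub>R (x - c)"
proof -
  let ?q = "\<lambda>x. r\<^sup>2 - (norm (x - c))\<^sup>2"
  have "((\<lambda>x. r\<^sup>2 - (x - c) \<bullet> (x - c)) has_derivative (\<lambda>h. - 2 * ((x - c) \<bullet> h))) (at x)"
    by (auto intro!: derivative_eq_intros simp: inner_commute)
  then have q: "(?q has_derivative (\<lambda>h. - 2 * ((x - c) \<bullet> h))) (at x)"
    by (simp add: power2_norm_eq_inner)
  have "((\<lambda>x. flat 1 (?q x)) has_derivative (\<lambda>h. flat [:0, 0, 1:] (?q x) * (- 2 * ((x - c) \<bullet> h)))) (at x)"
    using has_derivative_compose[OF q DERIV_flat[of 1 "?q x", unfolded has_field_derivative_def]] by simp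
  from pd_eqI[OF this] show ?thesis
    by (simp add: grad_def bump_def[abs_def] vec_eq_iff inner_axis algebra_simps)
qed

section \<open>Flux through a smooth surface\<close>

lemma has_derivative_grad:
  fixes f :: "point \<Rightarrow> real"
  assumes "f differentiable (at x)"
  shows "(f has_derivative (\<lambda>h. grad f x \<bullet> h)) (at x)"
proof -
  let ?D = "frechet_derivative f (at x)"
  have D: "(f has_derivative ?D) (at x)" using assms by (simp add: frechet_derivative_works)
  have "?D h = grad f x \<bullet> h" for h
  proof -
    have "?D h = ?D (\<Sum>i\<in>UNIV. h $ i *\<^sub>R axis i 1)"
      by (simp add: basis_expansion[of h, unfolded scalar_mult_eq_scaleR])
    also have "\<dots> = (\<Sum>i\<in>UNIV. h $ i * ?D (axis i 1))"
      using has_derivative_linear[OF D] by (simp add: linear_sum linear_scale)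
    finally show ?thesis by (simp add: grad_def inner_vec_def pd_def mult.commute)
  qed
  then have "?D = (\<lambda>h. grad f x \<bullet> h)" by blast
  then show ?thesis using D by simp
qed

text \<open>Suppose \<open>w\<close> points strictly into \<open>L = {\<rho> > 0}\<close> at \<open>x0\<close>, with unit normal \<open>a\<close>.  Take for
  \<open>\<psi>\<close> the bump of radius \<open>R\<close> around \<open>c = x0 - s a\<close>, with \<open>R^2 = s^2 (1 + \<kappa>^2)\<close>.  Only a cap of
  size \<open>O(\<kappa> s)\<close> of its support lies in \<open>L\<close>.  There \<open>x - c\<close> is nearly \<open>s a\<close>, so \<open>\<psi>\<close>
  decreases along \<open>w\<close>, and as the cap is near the edge of the bump, where
  \<open>|\<psi>'| / \<psi>\<close> is as large as \<open>1 / s^3\<close>, the term \<open>w \<bullet> grad \<psi>\<close> dominates \<open>\<psi> div w\<close>.\<close>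

lemma one_sided_flux_nonpos:
  fixes w :: "point \<Rightarrow> point" and \<rho> :: "point \<Rightarrow> real"
  assumes O: "open U" "x0 \<in> U" and w: "C1_on U w"
    and L: "open L" "L \<inter> U = {y \<in> U. \<rho> y > 0}"
    and \<rho>: "\<rho> differentiable (at x0)" "\<rho> x0 = 0"
    and I: "\<And>\<psi>. test_function U \<psi> \<Longrightarrow>
      integral\<^sup>L lebesgue (\<lambda>x. indicator L x * (w x \<bullet> grad \<psi> x + divergence w x * \<psi> x)) = 0"
  shows "w x0 \<bullet> grad \<rho> x0 \<le> 0"
proof (rule ccontr)
  assume "\<not> ?thesis"
  then have pos: "w x0 \<bullet> grad \<rho> x0 > 0" by simp
  define g where "g = grad \<rho> x0"
  have g: "g \<noteq> 0" "norm g > 0" using pos by (auto simp: g_def)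
  define a where "a = g /\<^sub>R norm g"
  have a: "norm a = 1" using g by (simp add: a_def)
  have aa: "a \<bullet> a = 1" using a by (simp add: norm_eq_1)
  have ga: "g = norm g *\<^sub>R a" using g by (simp add: a_def)
  define \<alpha> where "\<alpha> = w x0 \<bullet> a"
  have \<alpha>: "\<alpha> > 0" using pos g by (simp add: \<alpha>_def a_def g_def[symmetric] divide_inverse mult_pos_pos)
  define W where "W = norm (w x0) + \<alpha> / 4"
  have \<alpha>W: "\<alpha> \<le> norm (w x0)" using norm_cauchy_schwarz[of "w x0" a] a by (simp add: \<alpha>_def)
  \<comment> \<open>Points of the cap satisfy \<open>|x - x0| < 3 \<kappa> s\<close>; this \<open>\<kappa>\<close> keeps \<open>w\<close> times that distance
    below a quarter of the normal part.\<close>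
  define \<kappa> where "\<kappa> = \<alpha> / (12 * W)"
  have W: "W > 0" using \<alpha> by (simp add: W_def add_nonneg_pos)
  have \<kappa>: "\<kappa> > 0" "\<kappa> \<le> 1" "3 * \<kappa> * W = \<alpha> / 4"
    using W \<alpha> \<alpha>W by (auto simp: \<kappa>_def field_simps W_def)
  obtain d1 where d1: "d1 > 0" "\<And>x. dist x x0 < d1 \<Longrightarrow> norm (w x - w x0) < \<alpha> / 4"
  proof -
    have "isCont w x0" using C1_on_continuous[OF w] O continuous_on_eq_continuous_at by blast
    then show ?thesis using that \<alpha> unfolding continuous_at_eps_delta by (auto simp: dist_norm dest!: spec[of _ "\<alpha>/4"])
  qed
  define M where "M = \<bar>divergence w x0\<bar> + 1"
  obtain d2 where d2: "d2 > 0" "\<And>x. dist x x0 < d2 \<Longrightarrow> \<bar>divergence w x\<bar> < M"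
  proof -
    have "isCont (divergence w) x0" using C1_on_divergence[OF w] O continuous_on_eq_continuous_at by blast
    then obtain d where "d > 0" "\<And>x. dist x x0 < d \<Longrightarrow> \<bar>divergence w x - divergence w x0\<bar> < 1"
      unfolding continuous_at_eps_delta dist_norm real_norm_def by (meson zero_less_one)
    then show ?thesis using that[of d] unfolding M_def by (smt (verit))
  qed
  obtain d3 where d3: "d3 > 0"
    "\<And>x. norm (x - x0) < d3 \<Longrightarrow> \<bar>\<rho> x - g \<bullet> (x - x0)\<bar> \<le> (\<kappa> * norm g) * norm (x - x0)"
    using has_derivative_grad[OF \<rho>(1)] \<rho>(2) \<kappa> g unfolding has_derivative_at_alt g_def[symmetric]
    by (auto dest!: spec[of _ "\<kappa> * norm g"])
  obtain d4 where d4: "d4 > 0" "ball x0 d4 \<subseteq> U" using O open_contains_ball by blast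
  \<comment> \<open>The support lies within \<open>3 s\<close> of \<open>x0\<close>; the last entry of the minimum makes the gradient
    term beat the divergence term.\<close>
  define s where "s = Min {d1, d2, d3, d4, 1, \<alpha> / (4 * M)} / 4"
  have M: "M > 0" by (simp add: M_def)
  have s: "s > 0" "3 * s < d1" "3 * s < d2" "3 * s < d3" "3 * s < d4" "s < 1" "s * (4 * M) < \<alpha>"
  proof -
    let ?m = "Min {d1, d2, d3, d4, 1, \<alpha> / (4 * M)}"
    have m: "?m > 0" using d1 d2 d3 d4 \<alpha> M by simp
    have le: "?m \<le> d1" "?m \<le> d2" "?m \<le> d3" "?m \<le> d4" "?m \<le> 1" "?m \<le> \<alpha> / (4 * M)" by auto
    show "s > 0" "3 * s < d1" "3 * s < d2" "3 * s < d3" "3 * s < d4" "s < 1"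
      using m le unfolding s_def by linarith+
    have "s < \<alpha> / (4 * M)" using m le unfolding s_def by linarith
    then show "s * (4 * M) < \<alpha>" using M by (simp add: field_simps)
  qed
  define c where "c = x0 - s *\<^sub>R a"
  define R where "R = s * sqrt (1 + \<kappa>\<^sup>2)"
  have R2: "R\<^sup>2 = s\<^sup>2 + \<kappa>\<^sup>2 * s\<^sup>2" by (simp add: R_def power_mult_distrib algebra_simps)
  have Rs: "s < R" using s(1) \<kappa>(1) by (simp add: R_def)
  have R2s: "R \<le> 2 * s"
  proof -
    have "\<kappa>\<^sup>2 \<le> 1" using \<kappa> by (simp add: power_le_one)
    then have "sqrt (1 + \<kappa>\<^sup>2) \<le> 2" by (intro real_le_lsqrt) auto
    then show ?thesis using s(1) by (simp add: R_def)
  qed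
  have R0: "R > 0" using Rs s by simp
  have near: "norm (x - x0) \<le> 3 * s" if "x \<in> cball c R" for x
  proof -
    have "norm (x - x0) \<le> norm (x - c) + norm (s *\<^sub>R a)"
      using norm_triangle_ineq4[of "x - c" "s *\<^sub>R a"] by (simp add: c_def)
    then show ?thesis using that R2s a s by (simp add: dist_norm norm_minus_commute)
  qed
  have sub: "cball c R \<subseteq> ball x0 d4"
    using near s by (force simp: dist_norm norm_minus_commute)
  have inU: "x \<in> U" if "x \<in> ball c R" for x
    using sub d4(2) that ball_subset_cball by blast
  define \<psi> where "\<psi> = bump c R"
  have t: "test_function U \<psi>"
    unfolding test_function_def \<psi>_def using smooth_on_bump bump_eq_0[OF R0] sub d4(2)
    by (intro conjI exI[of _ "cball c R"]) auto
  define F where "F x = indicator L x * (w x \<bullet> grad \<psi> x + divergence w x * \<psi> x)" for x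
  have neg: "F x < 0" if x: "x \<in> L" "x \<in> ball c R" for x
  proof -
    define y where "y = x - x0"
    have y3: "norm y \<le> 3 * s" using near[of x] x by (simp add: y_def)
    have xU: "x \<in> U" using inU x(2) by simp
    have "\<rho> x > 0" using L(2) x xU by auto
    moreover have "\<bar>\<rho> x - g \<bullet> y\<bar> \<le> (\<kappa> * norm g) * norm y"
      using d3(2)[of x] y3 s by (simp add: y_def)
    ultimately have "g \<bullet> y > - ((\<kappa> * norm g) * norm y)" by linarith
    then have "norm g * (a \<bullet> y) > norm g * (- (\<kappa> * norm y))" by (subst (asm) ga) (simp add: algebra_simps)
    then have ay: "a \<bullet> y > - (\<kappa> * norm y)" using g(2) by (simp only: mult_less_cancel_left_pos)
    have xc: "x - c = y + s *\<^sub>R a" by (simp add: y_def c_def)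
    have nxc: "(norm (x - c))\<^sup>2 = (norm y)\<^sup>2 + 2 * s * (a \<bullet> y) + s\<^sup>2"
      unfolding xc power2_norm_eq_inner
      by (simp add: inner_add_left inner_add_right aa power2_eq_square inner_commute algebra_simps)
    define \<beta> where "\<beta> = R\<^sup>2 - (norm (x - c))\<^sup>2"
    \<comment> \<open>The argument of the exponential profile is positive but of order \<open>s^2\<close> on the cap.\<close>
    have \<beta>0: "\<beta> > 0" using bump_pos_iff[OF R0, of c x] x by (auto simp: bump_def flat_def \<beta>_def split: if_splits)
    have "s * (a \<bullet> y) \<ge> s * (- (\<kappa> * norm y))" using ay s(1) by (intro mult_left_mono) auto
    then have \<beta>1: "\<beta> \<le> \<kappa>\<^sup>2 * s\<^sup>2 - (norm y)\<^sup>2 + 2 * (s * \<kappa>) * norm y"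
      unfolding \<beta>_def R2 nxc by (simp add: algebra_simps)
    have "0 \<le> (norm y - s * \<kappa>)\<^sup>2" by simp
    then have \<beta>2: "\<beta> \<le> 2 * (\<kappa> * s)\<^sup>2" using \<beta>1 by (simp add: power2_eq_square algebra_simps)
    have ny: "norm y < 3 * (\<kappa> * s)"
    proof (rule ccontr)
      assume "\<not> ?thesis"
      then have h: "norm y \<ge> 3 * (\<kappa> * s)" by simp
      have ks: "\<kappa> * s > 0" using \<kappa> s by simp
      have "(3 * (\<kappa> * s)) * (\<kappa> * s) \<le> norm y * (norm y - 2 * (\<kappa> * s))"
        using h ks by (intro mult_mono) auto
      then have "3 * (\<kappa>\<^sup>2 * s\<^sup>2) \<le> (norm y)\<^sup>2 - 2 * (s * \<kappa>) * norm y" by (simp add: power2_eq_square algebra_simps)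
      moreover have "\<kappa>\<^sup>2 * s\<^sup>2 > 0" using \<kappa> s by simp
      ultimately show False using \<beta>1 \<beta>0 by linarith
    qed
    have wx: "norm (w x - w x0) < \<alpha> / 4" using d1(2)[of x] y3 s by (simp add: y_def dist_norm)
    have dx: "\<bar>divergence w x\<bar> < M" using d2(2)[of x] y3 s by (simp add: y_def dist_norm)
    have "\<bar>(w x - w x0) \<bullet> a\<bar> < \<alpha> / 4"
      using Cauchy_Schwarz_ineq2[of "w x - w x0" a] wx a by simp
    then have wa: "w x \<bullet> a \<ge> \<alpha> * 3 / 4"
      unfolding \<alpha>_def[symmetric] inner_diff_left by linarith
    have nw: "norm (w x) \<le> W" using wx norm_triangle_ineq2[of "w x" "w x0"] unfolding W_def by linarith
    have "\<bar>w x \<bullet> y\<bar> \<le> W * (3 * (\<kappa> * s))"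
      by (rule order_trans[OF Cauchy_Schwarz_ineq2]) (use nw ny W in \<open>auto intro!: mult_mono\<close>)
    also have "\<dots> = s * (3 * \<kappa> * W)" by simp
    also have "\<dots> = s * (\<alpha> / 4)" unfolding \<kappa>(3) ..
    finally have wy: "w x \<bullet> y \<ge> - (s * (\<alpha> / 4))" by linarith
    have "s * (w x \<bullet> a) \<ge> s * (\<alpha> * 3 / 4)" using wa s(1) by (intro mult_left_mono) auto
    then have wxc: "w x \<bullet> (x - c) \<ge> s * (\<alpha> / 2)"
      unfolding xc inner_add_right using wy by simp
    have b2: "\<beta>\<^sup>2 \<le> (2 * s\<^sup>2)\<^sup>2"
    proof (rule power_mono)
      have "(\<kappa> * s)\<^sup>2 \<le> s\<^sup>2" using \<kappa> s by (intro power_mono) (auto simp: mult_le_cancel_right1)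
      then show "\<beta> \<le> 2 * s\<^sup>2" using \<beta>2 by simp
    qed (use \<beta>0 in simp)
    have "M * \<beta>\<^sup>2 \<le> M * (2 * s\<^sup>2)\<^sup>2" using b2 M by (intro mult_left_mono) auto
    also have "\<dots> = (s * (4 * M)) * s * s\<^sup>2" by (simp add: power2_eq_square algebra_simps)
    also have "\<dots> \<le> (s * (4 * M)) * s * 1"
      using s M by (intro mult_left_mono) (auto simp: power_le_one)
    also have "\<dots> < \<alpha> * s" using s by (simp add: mult_strict_right_mono)
    finally have key: "M * \<beta>\<^sup>2 < \<alpha> * s" .
    have "\<psi> x = flat 1 \<beta>" by (simp add: \<psi>_def bump_def \<beta>_def)
    then have fl: "flat [:0, 0, 1:] \<beta> = exp (- (1 / \<beta>)) / \<beta>\<^sup>2" "\<psi> x = exp (- (1 / \<beta>))"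
      using \<beta>0 by (simp_all add: flat_def power2_eq_square)
    have "w x \<bullet> grad \<psi> x = - (2 * (w x \<bullet> (x - c)) / \<beta>\<^sup>2) * exp (- (1 / \<beta>))"
      unfolding \<psi>_def grad_bump \<beta>_def[symmetric] fl by simp
    also have "\<dots> \<le> - (\<alpha> * s / \<beta>\<^sup>2) * exp (- (1 / \<beta>))"
      using wxc by (intro mult_right_mono le_imp_neg_le divide_right_mono) (auto simp: mult.commute)
    also have "\<dots> < - M * exp (- (1 / \<beta>))"
    proof (rule mult_strict_right_mono)
      show "- (\<alpha> * s / \<beta>\<^sup>2) < - M" using key \<beta>0 by (simp add: pos_less_divide_eq)
    qed simp
    finally have "w x \<bullet> grad \<psi> x < - M * exp (- (1 / \<beta>))" .
    moreover have "divergence w x * \<psi> x \<le> M * exp (- (1 / \<beta>))"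
      unfolding fl using dx by (intro mult_right_mono) auto
    ultimately have "w x \<bullet> grad \<psi> x + divergence w x * \<psi> x < 0" by linarith
    then show ?thesis using x by (simp add: F_def)
  qed
  have zero: "F x = 0" if "x \<notin> L \<inter> ball c R" for x
  proof (cases "x \<in> L")
    case True
    then have "x \<notin> ball c R" using that by auto
    then have "\<psi> x = 0" "R\<^sup>2 - (norm (x - c))\<^sup>2 \<le> 0"
      using bump_pos_iff[OF R0, of c x] bump_nonneg[of c R x]
      by (auto simp: \<psi>_def bump_def flat_def split: if_splits)
    then show ?thesis by (simp add: F_def \<psi>_def grad_bump flat_def)
  qed (simp add: F_def)
  have Fi: "integrable lebesgue F"
  proof -
    have "C1_on UNIV \<psi>" unfolding \<psi>_def by (rule C1_on_smooth[OF open_UNIV smooth_on_bump])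
    then have gc: "continuous_on UNIV (grad \<psi>)" "continuous_on UNIV \<psi>"
      using C1_on_grad C1_on_continuous by auto
    define k where "k x = w x \<bullet> grad \<psi> x + divergence w x * \<psi> x" for x
    have kz: "k x = 0" if "x \<notin> cball c R" for x
      using bump_eq_0[OF R0 that] that R0
      by (simp add: k_def \<psi>_def grad_bump flat_def dist_norm norm_minus_commute power_mono)
    have "continuous_on (U \<union> - cball c R) k"
    proof (rule continuous_on_open_Un[OF O(1)])
      show "continuous_on U k" unfolding k_def
        by (intro continuous_intros C1_on_continuous[OF w] C1_on_divergence[OF w]
            continuous_on_subset[OF gc(1)] continuous_on_subset[OF gc(2)]) auto
      show "continuous_on (- cball c R) k"
        by (subst continuous_on_cong[OF refl, of _ _ "\<lambda>x. 0"]) (use kz in auto)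
    qed auto
    moreover have "U \<union> - cball c R = UNIV" using sub d4(2) by auto
    ultimately have "integrable lebesgue k"
      by (intro integrable_continuous_compact_support(1)[of _ "cball c R"] kz) auto
    then have "integrable lebesgue (\<lambda>x. indicator L x *\<^sub>R k x)"
      using L(1) by (intro integrable_mult_indicator) auto
    then show ?thesis by (simp add: F_def[abs_def] k_def)
  qed
  have Fn: "- F x \<ge> 0" for x using neg[of x] zero[of x] by (cases "x \<in> L \<inter> ball c R") auto
  have "integral\<^sup>L lebesgue (\<lambda>x. - F x) = 0" using I[OF t] by (simp add: F_def[abs_def])
  then have "AE x in lebesgue. - F x = 0"
    using Fi Fn by (subst (asm) integral_nonneg_eq_0_iff_AE) auto
  then have "AE x in lebesgue. x \<notin> L \<inter> ball c R"
  proof eventually_elim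
    case (elim x)
    then show ?case using neg[of x] by force
  qed
  moreover have "L \<inter> ball c R \<in> sets lebesgue" using L(1) by auto
  ultimately have "negligible (L \<inter> ball c R)"
    by (simp only: negligible_iff_null_sets AE_iff_null_sets)
  moreover have "open (L \<inter> ball c R)" using L(1) by auto
  \<comment> \<open>The ball reaches beyond \<open>x0\<close> in direction \<open>a\<close>, as \<open>R > s\<close>.\<close>
  moreover have "L \<inter> ball c R \<noteq> {}"
  proof -
    define q where "q = (R - s) / 2"
    have q: "q > 0" "q + s < R" using Rs by (auto simp: q_def field_simps)
    have qs: "q < s" using R2s Rs s by (simp add: q_def)
    define x where "x = x0 + q *\<^sub>R a"
    have "x - c = (q + s) *\<^sub>R a" by (simp add: x_def c_def algebra_simps)
    then have "norm (x - c) = q + s" using a q s by simp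
    then have xb: "x \<in> ball c R" using q by (simp add: dist_norm norm_minus_commute)
    have "norm (x - x0) = q" using a q by (simp add: x_def)
    then have "\<bar>\<rho> x - g \<bullet> (q *\<^sub>R a)\<bar> \<le> (\<kappa> * norm g) * q"
      using d3(2)[of x] qs s by (simp add: x_def)
    moreover have "g \<bullet> (q *\<^sub>R a) = q * norm g" by (subst ga) (simp add: aa)
    ultimately have "\<bar>\<rho> x - q * norm g\<bar> \<le> \<kappa> * (q * norm g)" by (simp only: mult.assoc mult.commute[of q])
    moreover have "\<kappa> < 1"
      using W \<alpha> \<alpha>W by (auto simp: \<kappa>_def field_simps W_def)
    then have "\<kappa> * (q * norm g) < 1 * (q * norm g)" using g q by (intro mult_strict_right_mono) auto
    ultimately have "\<rho> x > 0" by linarith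
    moreover have "x \<in> U" using xb inU by simp
    ultimately show ?thesis using L(2) xb by auto
  qed
  ultimately show False using open_not_negligible by blast
qed

lemma integrable_indicator_compact_support:
  fixes f :: "point \<Rightarrow> real"
  assumes U: "open U" "continuous_on U f" and C: "compact C" "C \<subseteq> U" "\<And>x. x \<notin> C \<Longrightarrow> f x = 0"
    and S: "S \<in> sets lebesgue"
  shows "integrable lebesgue (\<lambda>x. indicator S x * f x)"
proof -
  have "continuous_on (U \<union> - C) f"
  proof (rule continuous_on_open_Un[OF U(1)])
    show "open (- C)" using compact_imp_closed[OF C(1)] by auto
    show "continuous_on (- C) f"
      by (subst continuous_on_cong[OF refl, of _ _ "\<lambda>x. 0"]) (use C in auto)
  qed (rule U(2))
  moreover have "U \<union> - C = UNIV" using C(2) by auto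
  ultimately have "integrable lebesgue f"
    by (intro integrable_continuous_compact_support(1)[OF _ C(1) C(3)]) auto
  then have "integrable lebesgue (\<lambda>x. indicator S x *\<^sub>R f x)"
    using S by (intro integrable_mult_indicator) auto
  then show ?thesis by simp
qed

lemma integrable_mult_bounded_continuous:
  fixes g \<phi> :: "point \<Rightarrow> real"
  assumes g: "integrable lebesgue g" and \<phi>: "continuous_on UNIV \<phi>" "\<And>x. \<bar>\<phi> x\<bar> \<le> B"
  shows "integrable lebesgue (\<lambda>x. g x * \<phi> x)"
proof (rule Bochner_Integration.integrable_bound)
  show "integrable lebesgue (\<lambda>x. g x * B)" using g by (intro integrable_mult_left)
  show "(\<lambda>x. g x * \<phi> x) \<in> borel_measurable lebesgue"
    by (rule borel_measurable_times[OF borel_measurable_integrable[OF g] lebesgue_measurable_continuous[OF \<phi>(1)]])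
  have "B \<ge> 0" using \<phi>(2)[of 0] by linarith
  then show "AE x in lebesgue. norm (g x * \<phi> x) \<le> norm (g x * B)"
    using \<phi>(2) by (intro AE_I2) (auto simp: abs_mult intro!: mult_left_mono)
qed

lemma test_functionE:
  assumes "test_function U \<phi>"
  obtains C B where "compact C" "C \<subseteq> U" "\<And>x. x \<notin> C \<Longrightarrow> \<phi> x = 0" "\<And>x. x \<notin> C \<Longrightarrow> grad \<phi> x = 0"
    "C1_on UNIV \<phi>" "continuous_on UNIV \<phi>" "continuous_on UNIV (grad \<phi>)" "\<And>x. \<bar>\<phi> x\<bar> \<le> B"
proof -
  obtain C where C: "compact C" "C \<subseteq> U" "\<And>x. x \<notin> C \<Longrightarrow> \<phi> x = 0" and s: "smooth_on UNIV \<phi>"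
    using assms unfolding test_function_def by blast
  have c: "C1_on UNIV \<phi>" using C1_on_smooth[OF open_UNIV s] .
  have g: "grad \<phi> x = 0" if "x \<notin> C" for x
    using pd_zero_outside(2)[OF compact_imp_closed[OF C(1)] C(3) that]
    by (simp add: grad_def vec_eq_iff)
  have k: "continuous_on UNIV \<phi>" by (rule C1_on_continuous[OF c])
  have "bounded (\<phi> ` C)"
    using compact_imp_bounded[OF compact_continuous_image[OF continuous_on_subset[OF k] C(1)]] by auto
  then obtain b where b: "b > 0" "\<And>x. x \<in> C \<Longrightarrow> \<bar>\<phi> x\<bar> \<le> b" by (auto simp: bounded_pos)
  have "\<bar>\<phi> x\<bar> \<le> b" for x using b C(3)[of x] by (cases "x \<in> C") auto
  then show ?thesis using that[OF C g c k C1_on_grad[OF c]] by blast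
qed

lemma AE_not_in_negligible:
  assumes "negligible (N :: point set)"
  shows "AE x in lebesgue. x \<notin> N"
  using assms negligible_imp_sets[OF assms] by (simp add: negligible_iff_null_sets AE_iff_null_sets)

text \<open>Inside the open piece \<open>K\<close>, classical integration by parts identifies the weak divergence
  \<open>G\<close> with \<open>divergence u\<close> when tested with functions supported in \<open>K\<close>.  The
  cutoff argument extends this to test functions of the whole ball, which need not vanish on the
  boundary of \<open>K\<close>.\<close>

lemma weak_divergence_localize:
  fixes G :: "point \<Rightarrow> real"
  assumes U': "open U'" "cball x0 r \<subseteq> U'" "C1_on U' u" and K: "open K"
    and Gi: "integrable lebesgue (\<lambda>x. indicator (K \<inter> ball x0 r) x * G x)"
    and E: "\<And>\<phi>. test_function (K \<inter> ball x0 r) \<phi> \<Longrightarrow>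
      integral\<^sup>L lebesgue (\<lambda>x. indicator K x * (u x \<bullet> grad \<phi> x)) =
      - integral\<^sup>L lebesgue (\<lambda>x. indicator K x * (G x * \<phi> x))"
    and \<psi>: "test_function (ball x0 r) \<psi>"
  shows "integrable lebesgue (\<lambda>x. indicator K x * (G x * \<psi> x))"
    "integral\<^sup>L lebesgue (\<lambda>x. indicator K x * (G x * \<psi> x)) =
     integral\<^sup>L lebesgue (\<lambda>x. indicator K x * (divergence u x * \<psi> x))"
proof -
  let ?O = "ball x0 r"
  let ?D = "divergence u"
  have O: "open ?O" "?O \<subseteq> U'" using U'(2) ball_subset_cball[of x0 r] by auto
  have KO: "open (K \<inter> ?O)" using K by auto
  have uO: "C1_on ?O u" using C1_on_subset[OF U'(3) O(2)] .
  have Km: "K \<in> sets lebesgue" "K \<inter> ?O \<in> sets lebesgue" using K KO by auto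
  have Dc: "continuous_on U' ?D" by (rule C1_on_divergence[OF U'(3)])
  have "set_integrable lborel (cball x0 r) ?D"
    unfolding set_integrable_def
    using borel_integrable_compact[OF compact_cball continuous_on_subset[OF Dc U'(2)]]
    by (simp add: indicator_def of_bool_def if_distrib cong: if_cong)
  then have "integrable lebesgue (\<lambda>x. indicator (cball x0 r) x *\<^sub>R ?D x)"
    unfolding set_integrable_def using integrable_completion borel_measurable_integrable by blast
  then have "integrable lebesgue (\<lambda>x. indicator (K \<inter> ?O) x *\<^sub>R (indicator (cball x0 r) x *\<^sub>R ?D x))"
    by (rule integrable_mult_indicator[OF Km(2)])
  also have "(\<lambda>x. indicator (K \<inter> ?O) x *\<^sub>R (indicator (cball x0 r) x *\<^sub>R ?D x)) = (\<lambda>x. indicator (K \<inter> ?O) x * ?D x)"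
    by (auto simp: indicator_def fun_eq_iff)
  finally have Di: "integrable lebesgue (\<lambda>x. indicator (K \<inter> ?O) x * ?D x)" .
  define g where "g x = indicator (K \<inter> ?O) x * G x - indicator (K \<inter> ?O) x * ?D x" for x
  have gi: "integrable lebesgue g" unfolding g_def using Gi Di by (rule Bochner_Integration.integrable_diff)
  have prod: "integrable lebesgue (\<lambda>x. indicator K x * (G x * \<phi> x))"
      "integrable lebesgue (\<lambda>x. indicator K x * (?D x * \<phi> x))"
      "integral\<^sup>L lebesgue (\<lambda>x. g x * \<phi> x) =
       integral\<^sup>L lebesgue (\<lambda>x. indicator K x * (G x * \<phi> x)) -
       integral\<^sup>L lebesgue (\<lambda>x. indicator K x * (?D x * \<phi> x))" if "test_function ?O \<phi>" for \<phi>
  proof -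
    obtain C B where C: "compact C" "C \<subseteq> ?O" "\<And>x. x \<notin> C \<Longrightarrow> \<phi> x = 0" "\<And>x. x \<notin> C \<Longrightarrow> grad \<phi> x = 0"
      "C1_on UNIV \<phi>" "continuous_on UNIV \<phi>" "continuous_on UNIV (grad \<phi>)" "\<And>x. \<bar>\<phi> x\<bar> \<le> B"
      by (rule test_functionE[OF \<open>test_function ?O \<phi>\<close>]) (rule that)
    have eq: "(\<lambda>x. (indicator (K \<inter> ?O) x * h x) * \<phi> x) = (\<lambda>x. indicator K x * (h x * \<phi> x))" for h
    proof
      fix x show "(indicator (K \<inter> ?O) x * h x) * \<phi> x = indicator K x * (h x * \<phi> x)"
        using C(2) C(3)[of x] by (cases "x \<in> C") (auto simp: indicator_def)
    qed
    show i: "integrable lebesgue (\<lambda>x. indicator K x * (G x * \<phi> x))"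
      "integrable lebesgue (\<lambda>x. indicator K x * (?D x * \<phi> x))"
      using integrable_mult_bounded_continuous[OF Gi C(6) C(8)]
        integrable_mult_bounded_continuous[OF Di C(6) C(8)] unfolding eq by auto
    have "(\<lambda>x. g x * \<phi> x) = (\<lambda>x. indicator K x * (G x * \<phi> x) - indicator K x * (?D x * \<phi> x))"
      unfolding g_def left_diff_distrib fun_eq_iff using eq by metis
    then show "integral\<^sup>L lebesgue (\<lambda>x. g x * \<phi> x) =
       integral\<^sup>L lebesgue (\<lambda>x. indicator K x * (G x * \<phi> x)) -
       integral\<^sup>L lebesgue (\<lambda>x. indicator K x * (?D x * \<phi> x))"
      using i by simp
  qed
  have orth: "integral\<^sup>L lebesgue (\<lambda>x. g x * \<phi> x) = 0" if t: "test_function (K \<inter> ?O) \<phi>" for \<phi>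
  proof -
    have tO: "test_function ?O \<phi>" using t unfolding test_function_def by blast
    obtain C B where C: "compact C" "C \<subseteq> K \<inter> ?O" "\<And>x. x \<notin> C \<Longrightarrow> \<phi> x = 0" "\<And>x. x \<notin> C \<Longrightarrow> grad \<phi> x = 0"
      "C1_on UNIV \<phi>" "continuous_on UNIV \<phi>" "continuous_on UNIV (grad \<phi>)" "\<And>x. \<bar>\<phi> x\<bar> \<le> B"
      by (rule test_functionE[OF t]) (rule that)
    have CO: "C \<subseteq> ?O" using C(2) by blast
    have "continuous_on ?O (\<lambda>x. u x \<bullet> grad \<phi> x)"
      by (intro continuous_intros C1_on_continuous[OF uO] continuous_on_subset[OF C(7)]) auto
    then have i: "integrable lebesgue (\<lambda>x. indicator K x * (u x \<bullet> grad \<phi> x))"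
      by (rule integrable_indicator_compact_support[OF O(1) _ C(1) CO]) (use C Km in auto)
    have "integral\<^sup>L lebesgue (\<lambda>x. u x \<bullet> grad \<phi> x + ?D x * \<phi> x) = 0"
      by (rule integral_by_parts[OF O(1) uO C1_on_subset[OF C(5)] C(1) CO C(3)]) auto
    also have "(\<lambda>x. u x \<bullet> grad \<phi> x + ?D x * \<phi> x) =
        (\<lambda>x. indicator K x * (u x \<bullet> grad \<phi> x) + indicator K x * (?D x * \<phi> x))"
    proof
      fix x show "u x \<bullet> grad \<phi> x + ?D x * \<phi> x =
         indicator K x * (u x \<bullet> grad \<phi> x) + indicator K x * (?D x * \<phi> x)"
        using C(2) C(3)[of x] C(4)[of x] by (cases "x \<in> C") (auto simp: indicator_def)
    qed
    finally show ?thesis using i prod[OF tO] E[OF t] by simp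
  qed
  have s: "smooth_on UNIV \<psi>" using \<psi> unfolding test_function_def by blast
  obtain B where B: "\<And>x. \<bar>\<psi> x\<bar> \<le> B" by (rule test_functionE[OF \<psi>]) (rule that)
  have "integral\<^sup>L lebesgue (\<lambda>x. g x * \<psi> x) = 0"
    by (rule integral_test_functions_extend[OF KO gi orth s B]) (auto simp: g_def)
  then show "integrable lebesgue (\<lambda>x. indicator K x * (G x * \<psi> x))"
    "integral\<^sup>L lebesgue (\<lambda>x. indicator K x * (G x * \<psi> x)) =
     integral\<^sup>L lebesgue (\<lambda>x. indicator K x * (divergence u x * \<psi> x))"
    using prod[OF \<psi>] by auto
qed

text \<open>Integrating by parts with \<open>u1\<close> on the whole ball removes the contribution of \<open>K\<close> and
  leaves an identity on \<open>L\<close> for the difference of both extensions.  The factor \<open>c\<close> allows the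
  sign of the difference to be chosen later.\<close>

lemma flux_balance:
  fixes G :: "point \<Rightarrow> real" and c :: real
  assumes U': "open U'" "cball x0 r \<subseteq> U'" "C1_on U' u1" "C1_on U' u2" and K: "open K" and L: "open L"
    and dis: "K \<inter> L \<inter> ball x0 r = {}" and null: "negligible (ball x0 r - (K \<union> L))"
    and Gi: "integrable lebesgue (\<lambda>x. indicator (K \<inter> ball x0 r) x * G x)"
      "integrable lebesgue (\<lambda>x. indicator (L \<inter> ball x0 r) x * G x)"
    and E: "\<And>\<phi>. test_function (ball x0 r) \<phi> \<Longrightarrow>
      integral\<^sup>L lebesgue (\<lambda>x. indicator K x * (u1 x \<bullet> grad \<phi> x) + indicator L x * (u2 x \<bullet> grad \<phi> x)) =
      - integral\<^sup>L lebesgue (\<lambda>x. indicator K x * (G x * \<phi> x) + indicator L x * (G x * \<phi> x))"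
    and \<psi>: "test_function (ball x0 r) \<psi>"
  shows "integral\<^sup>L lebesgue (\<lambda>x. indicator L x *
     ((c *\<^sub>R (u2 x - u1 x)) \<bullet> grad \<psi> x + divergence (\<lambda>x. c *\<^sub>R (u2 x - u1 x)) x * \<psi> x)) = 0"
proof -
  let ?O = "ball x0 r"
  have O: "open ?O" "?O \<subseteq> U'" using U'(2) ball_subset_cball[of x0 r] by auto
  have m: "K \<in> sets lebesgue" "L \<in> sets lebesgue" using K L by auto
  have u1: "C1_on ?O u1" and u2: "C1_on ?O u2" using C1_on_subset[OF _ O(2)] U' by auto
  have E1: "integral\<^sup>L lebesgue (\<lambda>x. indicator K x * (u1 x \<bullet> grad \<phi> x)) =
      - integral\<^sup>L lebesgue (\<lambda>x. indicator K x * (G x * \<phi> x))" if t: "test_function (K \<inter> ?O) \<phi>" for \<phi>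
  proof -
    obtain C B where C: "compact C" "C \<subseteq> K \<inter> ?O" "\<And>x. x \<notin> C \<Longrightarrow> \<phi> x = 0" "\<And>x. x \<notin> C \<Longrightarrow> grad \<phi> x = 0"
      by (rule test_functionE[OF t]) (rule that)
    have z: "indicator L x * (u2 x \<bullet> grad \<phi> x) = 0" "indicator L x * (G x * \<phi> x) = 0" for x
      using C(2-4) dis by (cases "x \<in> C"; force simp: indicator_def)+
    show ?thesis using E[of \<phi>] t unfolding z test_function_def by auto
  qed
  have E2: "integral\<^sup>L lebesgue (\<lambda>x. indicator L x * (u2 x \<bullet> grad \<phi> x)) =
      - integral\<^sup>L lebesgue (\<lambda>x. indicator L x * (G x * \<phi> x))" if t: "test_function (L \<inter> ?O) \<phi>" for \<phi>
  proof -
    obtain C B where C: "compact C" "C \<subseteq> L \<inter> ?O" "\<And>x. x \<notin> C \<Longrightarrow> \<phi> x = 0" "\<And>x. x \<notin> C \<Longrightarrow> grad \<phi> x = 0"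
      by (rule test_functionE[OF t]) (rule that)
    have z: "indicator K x * (u1 x \<bullet> grad \<phi> x) = 0" "indicator K x * (G x * \<phi> x) = 0" for x
      using C(2-4) dis by (cases "x \<in> C"; force simp: indicator_def)+
    show ?thesis using E[of \<phi>] t unfolding z test_function_def by auto
  qed
  note l1 = weak_divergence_localize[OF U'(1,2,3) K Gi(1) E1 \<psi>]
  note l2 = weak_divergence_localize[OF U'(1,2,4) L Gi(2) E2 \<psi>]
  obtain C B where C: "compact C" "C \<subseteq> ?O" "\<And>x. x \<notin> C \<Longrightarrow> \<psi> x = 0" "\<And>x. x \<notin> C \<Longrightarrow> grad \<psi> x = 0"
      "C1_on UNIV \<psi>" "continuous_on UNIV \<psi>" "continuous_on UNIV (grad \<psi>)" "\<And>x. \<bar>\<psi> x\<bar> \<le> B"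
    by (rule test_functionE[OF \<psi>]) (rule that)
  have iu: "integrable lebesgue (\<lambda>x. indicator S x * (u x \<bullet> grad \<psi> x))"
    and id: "integrable lebesgue (\<lambda>x. indicator S x * (divergence u x * \<psi> x))"
    if "C1_on ?O u" "S \<in> sets lebesgue" for u S
  proof -
    have "continuous_on ?O (\<lambda>x. u x \<bullet> grad \<psi> x)" "continuous_on ?O (\<lambda>x. divergence u x * \<psi> x)"
      by (intro continuous_intros C1_on_continuous C1_on_divergence that
         continuous_on_subset[OF C(7)] continuous_on_subset[OF C(6)] subset_UNIV)+
    note k = this
    show "integrable lebesgue (\<lambda>x. indicator S x * (u x \<bullet> grad \<psi> x))"
      by (rule integrable_indicator_compact_support[OF O(1) k(1) C(1,2)]) (use C that in auto)
    show "integrable lebesgue (\<lambda>x. indicator S x * (divergence u x * \<psi> x))"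
      by (rule integrable_indicator_compact_support[OF O(1) k(2) C(1,2)]) (use C that in auto)
  qed
  have "integral\<^sup>L lebesgue (\<lambda>x. u1 x \<bullet> grad \<psi> x + divergence u1 x * \<psi> x) = 0"
    by (rule integral_by_parts[OF O(1) u1 C1_on_subset[OF C(5)] C(1,2,3)]) auto
  also have "integral\<^sup>L lebesgue (\<lambda>x. u1 x \<bullet> grad \<psi> x + divergence u1 x * \<psi> x) =
    integral\<^sup>L lebesgue (\<lambda>x. (indicator K x * (u1 x \<bullet> grad \<psi> x) + indicator K x * (divergence u1 x * \<psi> x))
      + (indicator L x * (u1 x \<bullet> grad \<psi> x) + indicator L x * (divergence u1 x * \<psi> x)))"
  proof (rule integral_cong_AE)
    have s: "integrable lebesgue (\<lambda>x. indicator UNIV x * (u1 x \<bullet> grad \<psi> x) + indicator UNIV x * (divergence u1 x * \<psi> x))"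
      using iu[OF u1, of UNIV] id[OF u1, of UNIV] by (intro Bochner_Integration.integrable_add) auto
    then show "(\<lambda>x. u1 x \<bullet> grad \<psi> x + divergence u1 x * \<psi> x) \<in> borel_measurable lebesgue"
      by (intro borel_measurable_integrable) simp
    show "(\<lambda>x. (indicator K x * (u1 x \<bullet> grad \<psi> x) + indicator K x * (divergence u1 x * \<psi> x))
      + (indicator L x * (u1 x \<bullet> grad \<psi> x) + indicator L x * (divergence u1 x * \<psi> x))) \<in> borel_measurable lebesgue"
      by (intro borel_measurable_integrable Bochner_Integration.integrable_add iu id u1 m)
    show "AE x in lebesgue. u1 x \<bullet> grad \<psi> x + divergence u1 x * \<psi> x =
      (indicator K x * (u1 x \<bullet> grad \<psi> x) + indicator K x * (divergence u1 x * \<psi> x))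
      + (indicator L x * (u1 x \<bullet> grad \<psi> x) + indicator L x * (divergence u1 x * \<psi> x))"
      using AE_not_in_negligible[OF null]
    proof eventually_elim
      case (elim x)
      show ?case
      proof (cases "x \<in> C")
        case True
        then have "x \<in> ?O" using C(2) by blast
        then consider "x \<in> K" "x \<notin> L" | "x \<notin> K" "x \<in> L" using elim dis by blast
        then show ?thesis by cases auto
      qed (simp add: C)
    qed
  qed
  also have "\<dots> = integral\<^sup>L lebesgue (\<lambda>x. indicator K x * (u1 x \<bullet> grad \<psi> x)) + integral\<^sup>L lebesgue (\<lambda>x. indicator K x * (divergence u1 x * \<psi> x))
     + integral\<^sup>L lebesgue (\<lambda>x. indicator L x * (u1 x \<bullet> grad \<psi> x)) + integral\<^sup>L lebesgue (\<lambda>x. indicator L x * (divergence u1 x * \<psi> x))"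
    using iu[OF u1 m(1)] iu[OF u1 m(2)] id[OF u1 m(1)] id[OF u1 m(2)] by simp
  finally have A: "integral\<^sup>L lebesgue (\<lambda>x. indicator K x * (u1 x \<bullet> grad \<psi> x)) + integral\<^sup>L lebesgue (\<lambda>x. indicator K x * (divergence u1 x * \<psi> x))
     + integral\<^sup>L lebesgue (\<lambda>x. indicator L x * (u1 x \<bullet> grad \<psi> x)) + integral\<^sup>L lebesgue (\<lambda>x. indicator L x * (divergence u1 x * \<psi> x)) = 0" .
  have Bq: "integral\<^sup>L lebesgue (\<lambda>x. indicator K x * (u1 x \<bullet> grad \<psi> x)) + integral\<^sup>L lebesgue (\<lambda>x. indicator L x * (u2 x \<bullet> grad \<psi> x))
    = - (integral\<^sup>L lebesgue (\<lambda>x. indicator K x * (divergence u1 x * \<psi> x)) + integral\<^sup>L lebesgue (\<lambda>x. indicator L x * (divergence u2 x * \<psi> x)))"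
    using E[OF \<psi>] iu[OF u1 m(1)] iu[OF u2 m(2)] l1 l2 by simp
  have dv: "divergence (\<lambda>x. c *\<^sub>R (u2 x - u1 x)) x = c * (divergence u2 x - divergence u1 x)" if "x \<in> ?O" for x
  proof -
    have "u1 differentiable (at x)" "u2 differentiable (at x)" using u1 u2 that by (auto simp: C1_on_def)
    then have "((\<lambda>x. c *\<^sub>R (u2 x - u1 x)) has_derivative
      (\<lambda>h. c *\<^sub>R (frechet_derivative u2 (at x) h - frechet_derivative u1 (at x) h))) (at x)"
      by (intro has_derivative_scaleR_right has_derivative_diff) (simp_all add: frechet_derivative_works)
    from pd_eqI[OF this] show ?thesis
      by (simp add: divergence_def pd_def sum_subtractf flip: sum_distrib_left)
  qed
  have "indicator L x * ((c *\<^sub>R (u2 x - u1 x)) \<bullet> grad \<psi> x + divergence (\<lambda>x. c *\<^sub>R (u2 x - u1 x)) x * \<psi> x) =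
     c * ((indicator L x * (u2 x \<bullet> grad \<psi> x) + indicator L x * (divergence u2 x * \<psi> x))
      - (indicator L x * (u1 x \<bullet> grad \<psi> x) + indicator L x * (divergence u1 x * \<psi> x)))" for x
  proof (cases "x \<in> C")
    case True
    then have "x \<in> ?O" using C(2) by blast
    show ?thesis unfolding dv[OF \<open>x \<in> ?O\<close>] by (simp add: inner_diff_left algebra_simps)
  qed (simp add: C)
  then show ?thesis using A Bq iu[OF u1 m(2)] id[OF u1 m(2)] iu[OF u2 m(2)] id[OF u2 m(2)] by simp
qed

section \<open>Normal continuity on mesh facets\<close>

lemma frontier_open_at_within:
  assumes "open K" "x \<in> frontier K"
  shows "at x within K \<noteq> bot"
proof -
  have "x \<in> closure K" "x \<notin> K" using assms by (auto simp: frontier_def interior_open)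
  then show ?thesis using trivial_limit_within[of x K] by (auto simp: closure_def)
qed

lemma trace_from_eq:
  assumes K: "open K" "x \<in> frontier K" and f: "\<And>y. y \<in> K \<Longrightarrow> f y = g y" and g: "isCont g x"
  shows "trace_from K f x = g x"
proof -
  have "(g \<longlongrightarrow> g x) (at x within K)" using g by (meson continuous_at_imp_continuous_at_within continuous_within)
  then have "(f \<longlongrightarrow> g x) (at x within K)"
    by (rule Lim_transform_within[OF _ zero_less_one]) (use f in auto)
  then show ?thesis
    unfolding trace_from_def by (rule tendsto_Lim[OF frontier_open_at_within[OF K]])
qed

lemma distr_lebesgue_plus: "distr lebesgue lebesgue ((+) (v::point)) = lebesgue"
  and measurable_lebesgue_plus: "(+) (v::point) \<in> lebesgue \<rightarrow>\<^sub>M lebesgue"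
proof -
  have T: "(\<lambda>x. v + (\<Sum>j\<in>Basis. (1 * (x \<bullet> j)) *\<^sub>R j)) = (+) v"
    by (simp add: euclidean_representation)
  show "distr lebesgue lebesgue ((+) v) = lebesgue"
    using lebesgue_affine_euclidean[of "\<lambda>_. 1" v] unfolding T by (simp add: density_1)
  show "(+) v \<in> lebesgue \<rightarrow>\<^sub>M lebesgue"
    using lebesgue_affine_measurable[of "\<lambda>_. 1" v] unfolding T by simp
qed

lemma integrable_lebesgue_shift:
  fixes f :: "point \<Rightarrow> real"
  assumes "integrable lebesgue f"
  shows "integrable lebesgue (\<lambda>x. f (v + x))"
proof -
  have "integrable (distr lebesgue lebesgue ((+) v)) f" using assms by (simp only: distr_lebesgue_plus)
  then show ?thesis by (rule integrable_distr[OF measurable_lebesgue_plus])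
qed

lemma fe_meshD:
  assumes "fe_mesh M"
  shows "open (domain M)" "finite (cells M)"
    "K \<in> cells M \<Longrightarrow> open K" "K \<in> cells M \<Longrightarrow> bounded K"
    "K \<in> cells M \<Longrightarrow> negligible (frontier K)"
    "F \<in> ifacets M \<Longrightarrow> interior_facet_of M F"
proof -
  have "\<forall>K\<in>cells M. open K \<and> connected K \<and> K \<noteq> {} \<and> bounded K \<and> negligible (frontier K)"
    using assms unfolding fe_mesh_def by (elim conjE) assumption
  then show "K \<in> cells M \<Longrightarrow> open K" "K \<in> cells M \<Longrightarrow> bounded K"
    "K \<in> cells M \<Longrightarrow> negligible (frontier K)" by simp_all
  have "\<forall>F\<in>ifacets M. interior_facet_of M F"
    using assms unfolding fe_mesh_def by (elim conjE) assumption
  then show "F \<in> ifacets M \<Longrightarrow> interior_facet_of M F" by simp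
  show "open (domain M)" using assms unfolding fe_mesh_def by (elim conjE) assumption
  show "finite (cells M)" using assms unfolding fe_mesh_def by (elim conjE) assumption
qed

text \<open>Cells next to a facet may be lattice translates of the representative cells; they inherit
  the properties of the latter.\<close>

lemma all_cellsE:
  assumes "fe_mesh M" "K \<in> all_cells M"
  obtains v K0 where "v \<in> lattice_of M" "K0 \<in> cells M" "K = (+) v ` K0"
    "open K" "negligible (frontier K)"
proof -
  obtain v K0 where v: "v \<in> lattice_of M" "K0 \<in> cells M" "K = (+) v ` K0"
    using assms(2) unfolding all_cells_def by blast
  have K0: "open K0" "negligible (frontier K0)"
    using fe_meshD(3,5)[OF assms(1) v(2)] by simp_all
  have "negligible (frontier K)" unfolding v(3) frontier_translation
    by (rule negligible_translation[OF K0(2)])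
  moreover have "open K" using K0(1) unfolding v(3) by (rule open_translation)
  ultimately show ?thesis using that v by blast
qed

lemma C1_on_shift:
  assumes "C1_on U g"
  shows "C1_on ((+) v ` U) (\<lambda>x. g (x - v))"
proof -
  have d: "((\<lambda>x. g (x - v)) has_derivative frechet_derivative g (at (x - v))) (at x)"
    if "x \<in> (+) v ` U" for x
  proof -
    have "x - v \<in> U" using that by auto
    then have "(g has_derivative frechet_derivative g (at (x - v))) (at (x - v))"
      using assms by (simp add: C1_on_def frechet_derivative_works)
    moreover have "((\<lambda>x. x - v) has_derivative (\<lambda>h. h)) (at x)"
      by (auto intro!: derivative_eq_intros)
    ultimately show ?thesis using has_derivative_compose by blast
  qed
  have p: "pd i (\<lambda>x. g (x - v)) x = pd i g (x - v)" if "x \<in> (+) v ` U" for x i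
    using pd_eqI[OF d[OF that]] by (simp add: pd_def)
  have "continuous_on ((+) v ` U) (pd i (\<lambda>x. g (x - v)))" for i
  proof (subst continuous_on_cong[OF refl])
    show "pd i (\<lambda>x. g (x - v)) x = pd i g (x - v)" if "x \<in> (+) v ` U" for x
      using p that by blast
    have "continuous_on U (pd i g)" using assms by (simp add: C1_on_def)
    then show "continuous_on ((+) v ` U) (\<lambda>x. pd i g (x - v))"
      by (rule continuous_on_compose2) (auto intro!: continuous_intros)
  qed
  then show ?thesis unfolding C1_on_def using d by (auto simp: differentiable_def)
qed

lemma cellwise_smooth_extension:
  assumes M: "fe_mesh M" and K: "K \<in> all_cells M" and u: "cellwise_smooth M u"
  obtains U g where "open U" "closure K \<subseteq> U" "C1_on U g" "\<And>x. x \<in> K \<Longrightarrow> u x = g x"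
proof -
  obtain v K0 where v: "v \<in> lattice_of M" "K0 \<in> cells M" "K = (+) v ` K0" "open K"
    by (rule all_cellsE[OF M K]) (rule that)
  obtain U g where U: "open U" "closure K0 \<subseteq> U" "smooth_on U g" "\<And>x. x \<in> K0 \<Longrightarrow> u x = g x"
    using bspec[OF conjunct2[OF u[unfolded cellwise_smooth_def]] v(2)] by (elim exE conjE) (simp add: that)
  have per: "u (v + x) = u x" if "x \<in> K0" for x
    using conjunct1[OF u[unfolded cellwise_smooth_def], unfolded periodic_field_def] v(1,2) that by blast
  show ?thesis
  proof (rule that)
    show "open ((+) v ` U)" using U(1) by (rule open_translation)
    show "closure K \<subseteq> (+) v ` U" unfolding v(3) closure_translation using U(2) by blast
    show "C1_on ((+) v ` U) (\<lambda>x. g (x - v))" by (rule C1_on_shift[OF C1_on_smooth[OF U(1,3)]])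
    show "u x = g (x - v)" if "x \<in> K" for x
      using that per U(4) unfolding v(3) by auto
  qed
qed

text \<open>Integrability of \<open>G\<close> is known on representative cells only and is carried to
  their translates by periodicity of \<open>G\<close> and translation invariance of the measure.\<close>

lemma L2_field_integrable_on_cell:
  fixes G :: "point \<Rightarrow> real"
  assumes M: "fe_mesh M" and K: "K \<in> all_cells M" and G: "L2_field M G" and B: "B \<in> sets lebesgue"
  shows "integrable lebesgue (\<lambda>x. indicator (K \<inter> B) x * G x)"
proof -
  obtain v K0 where v: "v \<in> lattice_of M" "K0 \<in> cells M" "K = (+) v ` K0" "open K"
    by (rule all_cellsE[OF M K]) (rule that)
  have K0: "open K0" "bounded K0" using fe_meshD(3-5)[OF M v(2)] by simp_all
  let ?S = "\<Union>(cells M)"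
  have K0m: "K0 \<in> sets lebesgue" using K0 by auto
  have K0i: "integrable lebesgue (indicat_real K0)"
    using K0 by (simp add: lmeasurable_iff_integrable[symmetric] lmeasurable_open)
  have m: "(\<lambda>x. indicator ?S x *\<^sub>R G x) \<in> borel_measurable lebesgue"
    using G unfolding L2_field_def set_borel_measurable_def by blast
  have s: "integrable lebesgue (\<lambda>x. indicator ?S x *\<^sub>R (norm (G x))\<^sup>2)"
    using G unfolding L2_field_def set_integrable_def by blast
  have i0: "integrable lebesgue (\<lambda>x. indicator K0 x * G x)"
  proof (rule Bochner_Integration.integrable_bound)
    show "integrable lebesgue (\<lambda>x. indicat_real K0 x + indicator ?S x *\<^sub>R (norm (G x))\<^sup>2)"
      using K0i s by (rule Bochner_Integration.integrable_add)
    have "(\<lambda>x. indicator K0 x * G x) = (\<lambda>x. indicator K0 x * (indicator ?S x *\<^sub>R G x))"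
      using v(2) by (auto simp: indicator_def fun_eq_iff)
    then show "(\<lambda>x. indicator K0 x * G x) \<in> borel_measurable lebesgue"
      using m K0m by simp
    have "\<bar>G x\<bar> \<le> 1 + (G x)\<^sup>2" for x
      using sum_squares_bound[of "\<bar>G x\<bar>" 1] by (simp; smt (verit) zero_le_power2)
    then show "AE x in lebesgue. norm (indicator K0 x * G x) \<le> norm (indicat_real K0 x + indicator ?S x *\<^sub>R (norm (G x))\<^sup>2)"
      using v(2) by (intro AE_I2) (auto simp: indicator_def)
  qed
  have "integrable lebesgue (\<lambda>x. indicator K0 (- v + x) * G (- v + x))"
    using integrable_lebesgue_shift[OF i0, of "- v"] .
  also have "(\<lambda>x. indicator K0 (- v + x) * G (- v + x)) = (\<lambda>x. indicator K x * G x)"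
  proof
    fix x
    have "x \<in> K \<longleftrightarrow> - v + x \<in> K0" unfolding v(3) by force
    moreover have "G (v + y) = G y" if "y \<in> K0" for y
      using G v that unfolding L2_field_def periodic_field_def by blast
    from this[of "- v + x"] have "- v + x \<in> K0 \<Longrightarrow> G x = G (- v + x)" by simp
    ultimately show "indicator K0 (- v + x) * G (- v + x) = indicator K x * G x"
      by (auto simp: indicator_def)
  qed
  finally have "integrable lebesgue (\<lambda>x. indicator B x *\<^sub>R (indicator K x * G x))"
    using B by (intro integrable_mult_indicator)
  also have "(\<lambda>x. indicator B x *\<^sub>R (indicator K x * G x)) = (\<lambda>x. indicator (K \<inter> B) x * G x)"
    by (auto simp: indicator_def fun_eq_iff)
  finally show ?thesis .
qed

lemma C1_on_scaled_diff:
  assumes "C1_on U f" "C1_on U g"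
  shows "C1_on U (\<lambda>x. c *\<^sub>R (f x - g x))"
proof -
  have d: "((\<lambda>x. c *\<^sub>R (f x - g x)) has_derivative
      (\<lambda>h. c *\<^sub>R (frechet_derivative f (at x) h - frechet_derivative g (at x) h))) (at x)" if "x \<in> U" for x
    using assms that by (intro has_derivative_scaleR_right has_derivative_diff)
      (simp_all add: C1_on_def frechet_derivative_works)
  have p: "pd i (\<lambda>x. c *\<^sub>R (f x - g x)) x = c *\<^sub>R (pd i f x - pd i g x)" if "x \<in> U" for x i
    using pd_eqI[OF d[OF that]] by (simp add: pd_def)
  have "continuous_on U (pd i (\<lambda>x. c *\<^sub>R (f x - g x)))" for i
    by (subst continuous_on_cong[OF refl p])
       (use assms in \<open>auto simp: C1_on_def intro!: continuous_intros\<close>)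
  then show ?thesis unfolding C1_on_def using d by (auto simp: differentiable_def)
qed

text \<open>Near a facet point the domain consists of the two adjacent cells and a null set, so the weak
  divergence identity takes the two-sided form required by \<open>flux_balance\<close>.  The one-sided
  estimate for both signs of the difference of the extensions then makes the normal components
  of the traces equal.\<close>

lemma normal_jump_eq_0:
  assumes M: "fe_mesh M" and F: "F \<in> ifacets M" and x: "x \<in> surf F"
    and u: "cellwise_smooth M u" "u \<in> Hdiv M"
  shows "jump F u x = 0"
proof -
  define K where "K = plus_cell F"
  define L where "L = minus_cell F"
  have "interior_facet_of M F" using fe_meshD(6)[OF M F] .
  then have F1: "surf F \<subseteq> domain M" "K \<in> all_cells M" "L \<in> all_cells M"
     "x \<in> frontier K" "x \<in> frontier L" "surf F \<subseteq> frontier K"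
     "separates_at (surf F) K L x (nplus F x)"
    using x unfolding interior_facet_of_def K_def L_def by blast+
  obtain W \<rho> where W: "open W" "x \<in> W" "smooth_on W \<rho>" "K \<inter> W = {y\<in>W. \<rho> y < 0}"
      "surf F \<inter> W = {y\<in>W. \<rho> y = 0}" "L \<inter> W = {y\<in>W. \<rho> y > 0}" "nplus F x = sgn (grad \<rho> x)"
    using F1(7) unfolding separates_at_def by blast
  have K: "open K" "negligible (frontier K)" by (rule all_cellsE[OF M F1(2)], assumption)+
  have L: "open L" by (rule all_cellsE[OF M F1(3)], assumption)
  obtain UK u1 where u1: "open UK" "closure K \<subseteq> UK" "C1_on UK u1" "\<And>y. y \<in> K \<Longrightarrow> u y = u1 y"
    by (rule cellwise_smooth_extension[OF M F1(2) u(1)]) (rule that)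
  obtain UL u2 where u2: "open UL" "closure L \<subseteq> UL" "C1_on UL u2" "\<And>y. y \<in> L \<Longrightarrow> u y = u2 y"
    by (rule cellwise_smooth_extension[OF M F1(3) u(1)]) (rule that)
  define U where "U = UK \<inter> UL \<inter> W \<inter> domain M"
  have "open (domain M)" by (rule fe_meshD(1)[OF M])
  then have U: "open U" "x \<in> U"
    using u1(1,2) u2(1,2) W(1,2) F1 x by (auto simp: U_def frontier_def)
  obtain r where r: "r > 0" "cball x r \<subseteq> U" using U open_contains_cball by blast
  let ?O = "ball x r"
  have OU: "?O \<subseteq> U" using r(2) ball_subset_cball[of x r] by blast
  have OW: "?O \<subseteq> W" "?O \<subseteq> domain M" using OU by (auto simp: U_def)
  have c1: "C1_on U u1" "C1_on U u2" 
    unfolding U_def by (rule C1_on_subset[OF u1(3)], blast, rule C1_on_subset[OF u2(3)], blast)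
  have dis: "K \<inter> L \<inter> ?O = {}"
  proof -
    have "(K \<inter> W) \<inter> (L \<inter> W) = {}" unfolding W(4,6) by auto
    then show ?thesis using OW(1) by blast
  qed
  have part: "y \<in> K \<or> y \<in> L \<or> y \<in> surf F" if "y \<in> ?O" for y
  proof -
    have "y \<in> W" using that OW(1) by blast
    moreover have "\<rho> y < 0 \<or> \<rho> y = 0 \<or> \<rho> y > 0" by linarith
    ultimately have "y \<in> {y\<in>W. \<rho> y < 0} \<or> y \<in> {y\<in>W. \<rho> y = 0} \<or> y \<in> {y\<in>W. \<rho> y > 0}"
      by simp
    then show ?thesis unfolding W(4-6)[symmetric] by blast
  qed
  then have null: "negligible (?O - (K \<union> L))"
    using F1(6) by (intro negligible_subset[OF K(2)]) blast
  obtain G where G: "L2_field M G" "weak_divergence M u G" using u(2) unfolding Hdiv_def by blast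
  note Gi = L2_field_integrable_on_cell[OF M F1(2) G(1), of ?O] L2_field_integrable_on_cell[OF M F1(3) G(1), of ?O]
  have Km: "K \<in> sets lebesgue" "L \<in> sets lebesgue" "?O \<in> sets lebesgue" using K L by auto
  have E: "integral\<^sup>L lebesgue (\<lambda>x. indicator K x * (u1 x \<bullet> grad \<phi> x) + indicator L x * (u2 x \<bullet> grad \<phi> x)) =
      - integral\<^sup>L lebesgue (\<lambda>x. indicator K x * (G x * \<phi> x) + indicator L x * (G x * \<phi> x))"
    if t: "test_function ?O \<phi>" for \<phi>
  proof -
    obtain C B where C: "compact C" "C \<subseteq> ?O" "\<And>x. x \<notin> C \<Longrightarrow> \<phi> x = 0" "\<And>x. x \<notin> C \<Longrightarrow> grad \<phi> x = 0"
      "C1_on UNIV \<phi>" "continuous_on UNIV \<phi>" "continuous_on UNIV (grad \<phi>)" "\<And>x. \<bar>\<phi> x\<bar> \<le> B"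
      by (rule test_functionE[OF t]) (rule that)
    have key: "set_lebesgue_integral lebesgue (domain M) h =
        integral\<^sup>L lebesgue (\<lambda>x. indicator K x * h1 x + indicator L x * h2 x)"
      if m: "(\<lambda>x. indicator K x * h1 x + indicator L x * h2 x) \<in> borel_measurable lebesgue"
        and h: "\<And>y. y \<in> K \<Longrightarrow> h y = h1 y" "\<And>y. y \<in> L \<Longrightarrow> h y = h2 y"
          "\<And>y. y \<notin> C \<Longrightarrow> h y = 0" "\<And>y. y \<notin> C \<Longrightarrow> h1 y = 0" "\<And>y. y \<notin> C \<Longrightarrow> h2 y = 0"
      for h h1 h2 :: "point \<Rightarrow> real"
    proof -
      have ae: "AE x in lebesgue. indicator K x * h1 x + indicator L x * h2 x = indicator (domain M) x *\<^sub>R h x"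
        using AE_not_in_negligible[OF null]
      proof eventually_elim
        case (elim y)
        show ?case
        proof (cases "y \<in> C")
          case True
          then have yO: "y \<in> ?O" and yM: "y \<in> domain M" using C(2) OW by blast+
          consider "y \<in> K" "y \<notin> L" | "y \<notin> K" "y \<in> L" using yO elim dis by blast
          then show ?thesis by cases (simp_all add: yM h(1,2))
        qed (use h in simp)
      qed
      have ae': "AE x in lebesgue. indicator (domain M) x *\<^sub>R h x = indicator K x * h1 x + indicator L x * h2 x"
        using ae by eventually_elim simp
      show ?thesis unfolding set_lebesgue_integral_def
        by (rule integral_cong_AE[OF borel_measurable_AE[OF m ae] m ae'])
    qed
    have td: "test_function (domain M) \<phi>" using t OW(2) unfolding test_function_def by blast
    have ucont: "continuous_on ?O (\<lambda>x. w x \<bullet> grad \<phi> x)" if "C1_on U w" for w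
      using C1_on_continuous[OF C1_on_subset[OF that OU]]
      by (intro continuous_intros continuous_on_subset[OF C(7)]) auto
    have int: "integrable lebesgue (\<lambda>x. indicator S x * (w x \<bullet> grad \<phi> x))"
      if "C1_on U w" "S \<in> sets lebesgue" for w S
      by (rule integrable_indicator_compact_support[OF open_ball ucont[OF that(1)] C(1,2) _ that(2)]) (simp add: C(4))
    have gint: "integrable lebesgue (\<lambda>x. indicator S x * (G x * \<phi> x))" if "S \<in> all_cells M" for S
    proof -
      have "(\<lambda>x. (indicator (S \<inter> ?O) x * G x) * \<phi> x) = (\<lambda>x. indicator S x * (G x * \<phi> x))"
      proof
        fix y show "(indicator (S \<inter> ?O) y * G y) * \<phi> y = indicator S y * (G y * \<phi> y)"
          using C(2) C(3)[of y] by (cases "y \<in> C") (auto simp: indicator_def)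
      qed
      then show ?thesis
        using integrable_mult_bounded_continuous[OF L2_field_integrable_on_cell[OF M that G(1) Km(3)] C(6,8)]
        by simp
    qed
    have "set_lebesgue_integral lebesgue (domain M) (\<lambda>x. u x \<bullet> grad \<phi> x) =
        integral\<^sup>L lebesgue (\<lambda>x. indicator K x * (u1 x \<bullet> grad \<phi> x) + indicator L x * (u2 x \<bullet> grad \<phi> x))"
      by (rule key, intro borel_measurable_integrable Bochner_Integration.integrable_add int c1 Km)
         (auto simp: u1(4) u2(4) C(4))
    moreover have "set_lebesgue_integral lebesgue (domain M) (\<lambda>x. G x * \<phi> x) =
        integral\<^sup>L lebesgue (\<lambda>x. indicator K x * (G x * \<phi> x) + indicator L x * (G x * \<phi> x))"
      by (rule key, intro borel_measurable_integrable Bochner_Integration.integrable_add gint F1)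
         (auto simp: C(3))
    ultimately show ?thesis using G(2) td unfolding weak_divergence_def by metis
  qed
  have \<rho>: "\<rho> differentiable (at x)" "\<rho> x = 0"
    using C1_on_smooth[OF W(1,3)] W(2,5) x by (auto simp: C1_on_def)
  have LO: "L \<inter> ?O = {y \<in> ?O. \<rho> y > 0}" using W(6) OW(1) by blast
  have flux: "(c *\<^sub>R (u2 x - u1 x)) \<bullet> grad \<rho> x \<le> 0" for c
  proof (rule one_sided_flux_nonpos[OF open_ball _ _ L LO \<rho>])
    show "x \<in> ?O" using r by simp
    show "C1_on ?O (\<lambda>x. c *\<^sub>R (u2 x - u1 x))"
      by (intro C1_on_scaled_diff C1_on_subset[OF _ OU] c1)
    show "integral\<^sup>L lebesgue (\<lambda>x. indicator L x *
     ((c *\<^sub>R (u2 x - u1 x)) \<bullet> grad \<psi> x + divergence (\<lambda>x. c *\<^sub>R (u2 x - u1 x)) x * \<psi> x)) = 0"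
      if "test_function ?O \<psi>" for \<psi>
      by (rule flux_balance[OF U(1) r(2) c1 K(1) L dis null Gi E that]) (use Km in auto)
  qed
  have "(u2 x - u1 x) \<bullet> grad \<rho> x = 0"
    using flux[of 1] flux[of "-1"] by (simp add: inner_diff_left)
  then have "u1 x \<bullet> nplus F x = u2 x \<bullet> nplus F x"
    unfolding W(7) sgn_div_norm by (simp add: inner_diff_left)
  moreover have "isCont u1 x" "isCont u2 x"
    using c1 U by (auto simp: C1_on_def differentiable_imp_continuous_within)
  then have "trp F u x = u1 x" "trm F u x = u2 x"
    using trace_from_eq[OF K(1) F1(4) u1(4)] trace_from_eq[OF L F1(5) u2(4)] by (auto simp: K_def L_def)
  ultimately show ?thesis by (simp add: jump_def)
qed

section \<open>Sampling finite-dimensional function spaces\<close>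

definition function_span :: "(point \<Rightarrow> 'b::real_vector) set \<Rightarrow> (point \<Rightarrow> 'b) set" where
  "function_span B = {\<lambda>x. \<Sum>b\<in>B. c b *\<^sub>R b x | c. True}"

lemma function_span_add: assumes "f \<in> function_span B" "g \<in> function_span B" shows "(\<lambda>x. f x + g x) \<in> function_span B"
proof -
  obtain c d where "f = (\<lambda>x. \<Sum>b\<in>B. c b *\<^sub>R b x)" "g = (\<lambda>x. \<Sum>b\<in>B. d b *\<^sub>R b x)"
    using assms by (auto simp: function_span_def)
  then show ?thesis unfolding function_span_def
    by (auto intro!: exI[of _ "\<lambda>b. c b + d b"] simp: scaleR_add_left sum.distrib)
qed

lemma function_span_scale: assumes "f \<in> function_span B" shows "(\<lambda>x. k *\<^sub>R f x) \<in> function_span B"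
proof -
  obtain c where "f = (\<lambda>x. \<Sum>b\<in>B. c b *\<^sub>R b x)" using assms by (auto simp: function_span_def)
  then show ?thesis unfolding function_span_def
    by (auto intro!: exI[of _ "\<lambda>b. k * c b"] simp: scaleR_sum_right)
qed

lemma function_span_zero: "(\<lambda>x. 0) \<in> function_span B"
  unfolding function_span_def by (auto intro!: exI[of _ "\<lambda>b. 0"])

lemma function_span_sum: "(\<And>j. j < N \<Longrightarrow> e j \<in> function_span B) \<Longrightarrow> (\<lambda>x. \<Sum>j<(N::nat). k j *\<^sub>R e j x) \<in> function_span B"
  by (induction N) (auto intro!: function_span_zero function_span_add function_span_scale)

lemma function_span_insert:
  assumes "finite B" "b \<notin> B"
  shows "f \<in> function_span (insert b B) \<longleftrightarrow> (\<exists>g\<in>function_span B. \<exists>k. f = (\<lambda>x. g x + k *\<^sub>R b x))"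
proof
  assume "f \<in> function_span (insert b B)"
  then obtain c where f: "f = (\<lambda>x. \<Sum>b\<in>insert b B. c b *\<^sub>R b x)" by (auto simp: function_span_def)
  have "(\<lambda>x. \<Sum>b\<in>B. c b *\<^sub>R b x) \<in> function_span B" by (auto simp: function_span_def)
  then show "\<exists>g\<in>function_span B. \<exists>k. f = (\<lambda>x. g x + k *\<^sub>R b x)"
    by (rule rev_bexI) (use assms f in \<open>auto intro!: exI[of _ "c b"] simp: add.commute\<close>)
next
  assume "\<exists>g\<in>function_span B. \<exists>k. f = (\<lambda>x. g x + k *\<^sub>R b x)"
  then obtain c k where f: "f = (\<lambda>x. (\<Sum>b\<in>B. c b *\<^sub>R b x) + k *\<^sub>R b x)" by (auto simp: function_span_def)
  have s: "(\<Sum>b'\<in>B. (c(b := k)) b' *\<^sub>R b' x) = (\<Sum>b\<in>B. c b *\<^sub>R b x)" for x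
    using assms by (intro sum.cong) auto
  have "f = (\<lambda>x. \<Sum>b'\<in>insert b B. (c(b := k)) b' *\<^sub>R b' x)"
    unfolding f sum.insert[OF assms] s by (simp add: add.commute)
  then show "f \<in> function_span (insert b B)" unfolding function_span_def by blast
qed

text \<open>Induction over the spanning set, as in Gaussian elimination: the new generator is replaced
  by its residual \<open>r\<close> after subtraction of the part reproduced by the existing samples.  If
  \<open>r\<close> does not vanish on \<open>S\<close>, a point where it is nonzero becomes a further sample.\<close>

lemma sampling_representation:
  fixes B :: "(point \<Rightarrow> 'b::real_inner) set"
  assumes "finite B"
  shows "\<exists>(N::nat) X d e. (\<forall>j<N. X j \<in> S \<and> e j \<in> function_span B) \<and>
    (\<forall>f\<in>function_span B. \<forall>x\<in>S. f x = (\<Sum>j<N. (f (X j) \<bullet> d j) *\<^sub>R e j x))"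
  using assms
proof (induction B)
  case empty
  show ?case by (rule exI[of _ 0]) (simp add: function_span_def)
next
  case (insert b B)
  obtain N :: nat and X d e where IH: "\<forall>j<N. X j \<in> S \<and> e j \<in> function_span B"
    "\<forall>f\<in>function_span B. \<forall>x\<in>S. f x = (\<Sum>j<N. (f (X j) \<bullet> d j) *\<^sub>R e j x)"
    using insert.IH by blast
  note spi = function_span_insert[OF insert.hyps]
  have sub: "g \<in> function_span (insert b B)" if "g \<in> function_span B" for g
    unfolding spi using that by (intro bexI[of _ g] exI[of _ 0]) auto
  define r where "r x = b x - (\<Sum>j<N. (b (X j) \<bullet> d j) *\<^sub>R e j x)" for x
  have rsp: "r \<in> function_span (insert b B)"
  proof -
    have "(\<lambda>x. (- 1) *\<^sub>R (\<Sum>j<N. (b (X j) \<bullet> d j) *\<^sub>R e j x)) \<in> function_span B"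
      using IH(1) by (intro function_span_scale function_span_sum) auto
    then show ?thesis unfolding spi
      by (rule rev_bexI) (auto intro!: exI[of _ 1] simp: r_def fun_eq_iff)
  qed
  have rep: "\<exists>k. \<forall>x\<in>S. f x = (\<Sum>j<N. (f (X j) \<bullet> d j) *\<^sub>R e j x) + k *\<^sub>R r x"
    if f: "f \<in> function_span (insert b B)" for f
  proof -
    obtain g k where g: "g \<in> function_span B" "f = (\<lambda>x. g x + k *\<^sub>R b x)" using f unfolding spi by blast
    have "f x = (\<Sum>j<N. (f (X j) \<bullet> d j) *\<^sub>R e j x) + k *\<^sub>R r x" if "x \<in> S" for x
    proof -
      have "(\<Sum>j<N. (f (X j) \<bullet> d j) *\<^sub>R e j x) =
        (\<Sum>j<N. (g (X j) \<bullet> d j) *\<^sub>R e j x) + k *\<^sub>R (\<Sum>j<N. (b (X j) \<bullet> d j) *\<^sub>R e j x)"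
        by (simp add: g(2) inner_add_left scaleR_add_left sum.distrib scaleR_sum_right)
      also have "(\<Sum>j<N. (g (X j) \<bullet> d j) *\<^sub>R e j x) = g x" using IH(2) g(1) that by metis
      finally show ?thesis by (simp add: r_def g(2) scaleR_diff_right)
    qed
    then show ?thesis by blast
  qed
  show ?case
  proof (cases "\<forall>x\<in>S. r x = 0")
    case True
    have "\<forall>f\<in>function_span (insert b B). \<forall>x\<in>S. f x = (\<Sum>j<N. (f (X j) \<bullet> d j) *\<^sub>R e j x)"
    proof (intro ballI)
      fix f x assume f: "f \<in> function_span (insert b B)" and x: "x \<in> S"
      obtain k where "f x = (\<Sum>j<N. (f (X j) \<bullet> d j) *\<^sub>R e j x) + k *\<^sub>R r x"
        using rep[OF f] x by blast
      then show "f x = (\<Sum>j<N. (f (X j) \<bullet> d j) *\<^sub>R e j x)" using True x by simp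
    qed
    then show ?thesis using IH(1) sub by blast
  next
    case False
    then obtain y where y: "y \<in> S" "r y \<noteq> 0" by blast
    define v where "v = r y /\<^sub>R (r y \<bullet> r y)"
    have rv: "r y \<bullet> v = 1" using y by (simp add: v_def)
    define X' where "X' = X(N := y)"
    define d' where "d' = d(N := v)"
    \<comment> \<open>The old functions are corrected so that they do not contribute to the new sample.\<close>
    define e' where "e' = (\<lambda>j. if j < N then (\<lambda>x. e j x + (- (e j y \<bullet> v)) *\<^sub>R r x) else r)"
    have 1: "\<forall>j<Suc N. X' j \<in> S \<and> e' j \<in> function_span (insert b B)"
    proof (intro allI impI)
      fix j assume j: "j < Suc N"
      show "X' j \<in> S \<and> e' j \<in> function_span (insert b B)"
      proof (cases "j < N")
        case True
        then have "X j \<in> S" "e j \<in> function_span (insert b B)" using IH(1) sub by auto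
        moreover from this(2) have "(\<lambda>x. e j x + (- (e j y \<bullet> v)) *\<^sub>R r x) \<in> function_span (insert b B)"
          by (rule function_span_add[OF _ function_span_scale[OF rsp]])
        ultimately show ?thesis using True by (simp add: X'_def e'_def)
      next
        case False
        then show ?thesis using j rsp y by (simp add: X'_def e'_def less_Suc_eq)
      qed
    qed
    have 2: "f x = (\<Sum>j<Suc N. (f (X' j) \<bullet> d' j) *\<^sub>R e' j x)"
      if f: "f \<in> function_span (insert b B)" and x: "x \<in> S" for f x
    proof -
      obtain k where k: "\<And>x. x \<in> S \<Longrightarrow> f x = (\<Sum>j<N. (f (X j) \<bullet> d j) *\<^sub>R e j x) + k *\<^sub>R r x"
        using rep[OF f] by blast
      have "f y \<bullet> v = (\<Sum>j<N. (f (X j) \<bullet> d j) * (e j y \<bullet> v)) + k"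
        by (subst k[OF y(1)]) (simp add: inner_add_left inner_sum_left rv)
      moreover have "(\<Sum>j<Suc N. (f (X' j) \<bullet> d' j) *\<^sub>R e' j x) =
         (\<Sum>j<N. (f (X j) \<bullet> d j) *\<^sub>R (e j x + (- (e j y \<bullet> v)) *\<^sub>R r x)) + (f y \<bullet> v) *\<^sub>R r x"
        by (simp add: X'_def d'_def e'_def)
      moreover have "(\<Sum>j<N. (f (X j) \<bullet> d j) *\<^sub>R (e j x + (- (e j y \<bullet> v)) *\<^sub>R r x)) =
         (\<Sum>j<N. (f (X j) \<bullet> d j) *\<^sub>R e j x) - (\<Sum>j<N. (f (X j) \<bullet> d j) * (e j y \<bullet> v)) *\<^sub>R r x"
        by (simp add: scaleR_add_right sum.distrib scaleR_sum_left sum_subtractf scaleR_diff_right)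
      ultimately show ?thesis using k[OF x] by (simp add: scaleR_add_left)
    qed
    show ?thesis using 1 2 by blast
  qed
qed

section \<open>Time derivatives of separable fields\<close>

text \<open>A class of integrands on the cells that contains the components of all finite element
  functions and, unlike integrability, is closed under products.\<close>

definition bounded_measurable :: "mesh \<Rightarrow> (point \<Rightarrow> real) \<Rightarrow> bool" where
  "bounded_measurable M E \<longleftrightarrow> (\<lambda>x. indicator (\<Union>(cells M)) x * E x) \<in> borel_measurable lebesgue \<and>
     (\<exists>B. \<forall>x\<in>\<Union>(cells M). \<bar>E x\<bar> \<le> B)"

lemma bounded_measurable_cong:
  assumes "bounded_measurable M E" "\<And>x. x \<in> \<Union>(cells M) \<Longrightarrow> D x = E x" shows "bounded_measurable M D"
proof -
  have "(\<lambda>x. indicator (\<Union>(cells M)) x * D x) = (\<lambda>x. indicator (\<Union>(cells M)) x * E x)"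
    using assms(2) by (auto simp: indicator_def fun_eq_iff)
  then show ?thesis using assms unfolding bounded_measurable_def by simp
qed

lemma bounded_measurable_mult:
  assumes "bounded_measurable M D" "bounded_measurable M E" shows "bounded_measurable M (\<lambda>x. D x * E x)"
proof -
  obtain B C where B: "\<forall>x\<in>\<Union>(cells M). \<bar>D x\<bar> \<le> B" "\<forall>x\<in>\<Union>(cells M). \<bar>E x\<bar> \<le> C"
    using assms unfolding bounded_measurable_def by blast
  have "\<forall>x\<in>\<Union>(cells M). \<bar>D x * E x\<bar> \<le> \<bar>B\<bar> * \<bar>C\<bar>"
  proof
    fix x assume "x \<in> \<Union>(cells M)"
    then have "\<bar>D x\<bar> \<le> \<bar>B\<bar>" "\<bar>E x\<bar> \<le> \<bar>C\<bar>" using B by force+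
    then show "\<bar>D x * E x\<bar> \<le> \<bar>B\<bar> * \<bar>C\<bar>" by (simp add: abs_mult mult_mono)
  qed
  moreover have "(\<lambda>x. (indicator (\<Union>(cells M)) x * D x) * (indicator (\<Union>(cells M)) x * E x)) \<in> borel_measurable lebesgue"
    by (rule borel_measurable_times[OF assms[unfolded bounded_measurable_def, THEN conjunct1]])
  moreover have "(\<lambda>x. (indicator (\<Union>(cells M)) x * D x) * (indicator (\<Union>(cells M)) x * E x)) =
     (\<lambda>x. indicator (\<Union>(cells M)) x * (D x * E x))" by (auto simp: indicator_def fun_eq_iff)
  ultimately show ?thesis unfolding bounded_measurable_def by auto
qed

lemma bounded_measurable_add:
  assumes "bounded_measurable M D" "bounded_measurable M E" shows "bounded_measurable M (\<lambda>x. D x + E x)"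
proof -
  obtain B C where B: "\<forall>x\<in>\<Union>(cells M). \<bar>D x\<bar> \<le> B" "\<forall>x\<in>\<Union>(cells M). \<bar>E x\<bar> \<le> C"
    using assms unfolding bounded_measurable_def by blast
  have "\<forall>x\<in>\<Union>(cells M). \<bar>D x + E x\<bar> \<le> B + C"
    using B by (meson abs_triangle_ineq add_mono order_trans)
  moreover have "(\<lambda>x. indicator (\<Union>(cells M)) x * D x + indicator (\<Union>(cells M)) x * E x) \<in> borel_measurable lebesgue"
    by (rule borel_measurable_add[OF assms[unfolded bounded_measurable_def, THEN conjunct1]])
  ultimately show ?thesis unfolding bounded_measurable_def by (auto simp: distrib_left)
qed

lemma cells_open: "fe_mesh M \<Longrightarrow> open (\<Union>(cells M))"
  using fe_meshD(3) by (auto intro: open_Union)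

lemma bounded_measurable_const:
  assumes "fe_mesh M" shows "bounded_measurable M (\<lambda>x. c)"
proof -
  have "(\<lambda>x. indicator (\<Union>(cells M)) x * c) \<in> borel_measurable lebesgue"
    by (intro borel_measurable_times borel_measurable_indicator borel_measurable_const)
       (use cells_open[OF assms] in auto)
  then show ?thesis unfolding bounded_measurable_def by auto
qed

lemma bounded_measurable_integrable:
  assumes M: "fe_mesh M" and E: "bounded_measurable M E"
  shows "set_integrable lebesgue (\<Union>(cells M)) E"
proof -
  let ?S = "\<Union>(cells M)"
  have S: "open ?S" "bounded ?S"
    using cells_open[OF M] fe_meshD[OF M] by (auto intro: bounded_Union)
  obtain B where B: "\<And>x. x \<in> ?S \<Longrightarrow> \<bar>E x\<bar> \<le> B" using E unfolding bounded_measurable_def by blast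
  have "integrable lebesgue (\<lambda>x. indicator ?S x * E x)"
  proof (rule Bochner_Integration.integrable_bound)
    have "integrable lebesgue (indicat_real ?S)"
      using S by (simp only: lmeasurable_iff_integrable[symmetric] lmeasurable_open)
    then show "integrable lebesgue (\<lambda>x. indicat_real ?S x * B)" by (rule integrable_mult_left)
    show "(\<lambda>x. indicator ?S x * E x) \<in> borel_measurable lebesgue" using E unfolding bounded_measurable_def by blast
    show "AE x in lebesgue. norm (indicator ?S x * E x) \<le> norm (indicat_real ?S x * B)"
      using B by (intro AE_I2) (force simp: indicator_def)
  qed
  then show ?thesis by (simp add: set_integrable_def)
qed

lemma bounded_measurable_cellwise_smooth:
  fixes u :: "point \<Rightarrow> 'b::euclidean_space"
  assumes M: "fe_mesh M" and u: "cellwise_smooth M u"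
  shows "bounded_measurable M (\<lambda>x. u x \<bullet> b)"
proof -
  let ?S = "\<Union>(cells M)"
  have ext: "\<exists>U g. open U \<and> closure K \<subseteq> U \<and> continuous_on U g \<and> (\<forall>x\<in>K. u x = g x)" if "K \<in> cells M" for K
    using bspec[OF conjunct2[OF u[unfolded cellwise_smooth_def]] that] smooth_on_continuous by blast
  have c: "continuous_on K u" if K: "K \<in> cells M" for K
  proof -
    obtain U g where g: "open U" "closure K \<subseteq> U" "continuous_on U g" "\<forall>x\<in>K. u x = g x"
      using ext[OF K] by blast
    have "continuous_on K g" using g(2,3) closure_subset continuous_on_subset by blast
    then show ?thesis by (subst continuous_on_cong[OF refl]) (use g(4) in auto)
  qed
  have bd: "bounded (u ` K)" if K: "K \<in> cells M" for K
  proof -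
    obtain U g where g: "open U" "closure K \<subseteq> U" "continuous_on U g" "\<forall>x\<in>K. u x = g x"
      using ext[OF K] by blast
    have "compact (closure K)" using fe_meshD(4)[OF M K] by simp
    then have "bounded (g ` closure K)"
      using compact_continuous_image[OF continuous_on_subset[OF g(3,2)]] compact_imp_bounded by blast
    moreover have "u ` K \<subseteq> g ` closure K"
    proof
      fix z assume "z \<in> u ` K"
      then obtain x where "x \<in> K" "z = g x" using g(4) by auto
      then show "z \<in> g ` closure K" using closure_subset[of K] by blast
    qed
    ultimately show ?thesis by (rule bounded_subset)
  qed
  have "continuous_on (\<Union>K\<in>cells M. K) u"
    by (rule continuous_on_open_UN) (use c fe_meshD(3)[OF M] in auto)
  then have cS: "continuous_on ?S (\<lambda>x. u x \<bullet> b)" by (intro continuous_intros) auto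
  have "(\<lambda>x. indicator ?S x *\<^sub>R (u x \<bullet> b)) \<in> borel_measurable borel"
    using cells_open[OF M] by (intro borel_measurable_continuous_on_indicator cS) auto
  then have m: "(\<lambda>x. indicator ?S x * (u x \<bullet> b)) \<in> borel_measurable lebesgue"
    by (simp add: measurable_completion)
  have "bounded (\<Union>K\<in>cells M. u ` K)" using bd fe_meshD(2)[OF M] by (intro bounded_UN) auto
  then obtain C where C: "\<And>K x. K \<in> cells M \<Longrightarrow> x \<in> K \<Longrightarrow> norm (u x) \<le> C" by (auto simp: bounded_iff)
  have "\<bar>u x \<bullet> b\<bar> \<le> C * norm b" if "x \<in> ?S" for x
  proof -
    have "\<bar>u x \<bullet> b\<bar> \<le> norm (u x) * norm b" by (rule Cauchy_Schwarz_ineq2)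
    also have "\<dots> \<le> C * norm b" using C that by (intro mult_right_mono) auto
    finally show ?thesis .
  qed
  then show ?thesis using m unfolding bounded_measurable_def by blast
qed

lemma dom_integral_cong: "(\<And>x. x \<in> \<Union>(cells M) \<Longrightarrow> f x = g x) \<Longrightarrow> dom_integral M f = dom_integral M g"
  unfolding dom_integral_def set_lebesgue_integral_def
  by (rule Bochner_Integration.integral_cong) (auto simp: indicator_def)

lemma dom_integral_add:
  assumes "fe_mesh M" "bounded_measurable M f" "bounded_measurable M g"
  shows "dom_integral M (\<lambda>x. f x + g x) = dom_integral M f + dom_integral M g"
  unfolding dom_integral_def using bounded_measurable_integrable assms by (intro set_integral_add) auto

lemma dom_integral_cmult: "dom_integral M (\<lambda>x. c * f x) = c * dom_integral M f"
  unfolding dom_integral_def by simp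

text \<open>A field that is a finite sum of products \<open>a(s) E(x)\<close> on \<open>T\<close> and on the cells, together
  with its time derivative at \<open>t\<close>.  The congruence rule is part of the definition since the
  fields are arbitrary outside \<open>T\<close> and on the mesh skeleton.\<close>

inductive separable :: "mesh \<Rightarrow> real set \<Rightarrow> real \<Rightarrow> (real \<Rightarrow> point \<Rightarrow> real) \<Rightarrow> (point \<Rightarrow> real) \<Rightarrow> bool"
  for M T t where
  product: "(a has_real_derivative a') (at t within T) \<Longrightarrow> bounded_measurable M E \<Longrightarrow>
     separable M T t (\<lambda>s x. a s * E x) (\<lambda>x. a' * E x)"
| add: "separable M T t h h' \<Longrightarrow> separable M T t k k' \<Longrightarrow>
     separable M T t (\<lambda>s x. h s x + k s x) (\<lambda>x. h' x + k' x)"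
| cong: "separable M T t h h' \<Longrightarrow> (\<And>s x. s \<in> T \<Longrightarrow> x \<in> \<Union>(cells M) \<Longrightarrow> k s x = h s x) \<Longrightarrow>
     (\<And>x. x \<in> \<Union>(cells M) \<Longrightarrow> k' x = h' x) \<Longrightarrow> separable M T t k k'"

lemma separable_const: "fe_mesh M \<Longrightarrow> separable M T t (\<lambda>s x. c) (\<lambda>x. 0)"
  using separable.product[of "\<lambda>s. 1" 0 t T M "\<lambda>x. c"] by (simp add: bounded_measurable_const)

lemma separable_mult:
  assumes t: "t \<in> T" and h: "separable M T t h h'" and k: "separable M T t k k'"
  shows "separable M T t (\<lambda>s x. h s x * k s x) (\<lambda>x. h' x * k t x + h t x * k' x)"
  using h
proof induction
  case (product a a' E)
  from k show ?case
  proof induction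
    case (product b b' F)
    show ?case
      by (rule separable.cong[OF separable.product[OF DERIV_mult[OF \<open>(a has_real_derivative a') _\<close> product(1)]
          bounded_measurable_mult[OF \<open>bounded_measurable M E\<close> product(2)]]]) (simp_all add: algebra_simps)
  next
    case (add k k' l l')
    show ?case by (rule separable.cong[OF separable.add[OF add.IH]]) (simp_all add: algebra_simps)
  next
    case (cong k k' l l')
    show ?case by (rule separable.cong[OF cong.IH]) (simp_all add: cong.hyps t)
  qed
next
  case (add k k' l l')
  show ?case by (rule separable.cong[OF separable.add[OF add.IH]]) (simp_all add: algebra_simps)
next
  case (cong k k' l l')
  show ?case by (rule separable.cong[OF cong.IH]) (simp_all add: cong.hyps t)
qed

lemma separable_sum:
  assumes "fe_mesh M" "\<And>j. j < (N::nat) \<Longrightarrow> (a j has_real_derivative a' j) (at t within T) \<and> bounded_measurable M (E j)"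
  shows "separable M T t (\<lambda>s x. \<Sum>j<N. a j s * E j x) (\<lambda>x. \<Sum>j<N. a' j * E j x)"
  using assms(2)
proof (induction N)
  case 0
  then show ?case using separable_const[OF assms(1), of T t 0] by simp
next
  case (Suc N)
  then show ?case using separable.add[OF Suc.IH separable.product[of "a N" "a' N"]] by simp
qed

lemma separable_bounded_measurable:
  assumes "separable M T t h h'"
  shows "bounded_measurable M h'" "s \<in> T \<Longrightarrow> bounded_measurable M (h s)"
proof -
  have c: "bounded_measurable M (\<lambda>x. c * E x)" if "bounded_measurable M E" for c :: real and E
  proof -
    obtain B where B: "\<forall>x\<in>\<Union>(cells M). \<bar>E x\<bar> \<le> B" using \<open>bounded_measurable M E\<close> unfolding bounded_measurable_def by blast
    have "(\<lambda>x. c * (indicator (\<Union>(cells M)) x * E x)) \<in> borel_measurable lebesgue"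
      by (rule borel_measurable_times[OF borel_measurable_const that[unfolded bounded_measurable_def, THEN conjunct1]])
    then have "(\<lambda>x. indicator (\<Union>(cells M)) x * (c * E x)) \<in> borel_measurable lebesgue"
      by (simp add: mult.left_commute)
    moreover have "\<forall>x\<in>\<Union>(cells M). \<bar>c * E x\<bar> \<le> \<bar>c\<bar> * B"
      using B by (simp add: abs_mult mult_left_mono)
    ultimately show ?thesis unfolding bounded_measurable_def by blast
  qed
  have "bounded_measurable M h' \<and> (\<forall>s\<in>T. bounded_measurable M (h s))"
    using assms
  proof induction
    case (product a a' E)
    then show ?case using c by blast
  next
    case (add h h' k k')
    then show ?case using bounded_measurable_add by blast
  next
    case (cong h h' k k')
    then show ?case by (metis bounded_measurable_cong)
  qed
  then show "bounded_measurable M h'" "s \<in> T \<Longrightarrow> bounded_measurable M (h s)" by auto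
qed

lemma separable_derivative:
  assumes M: "fe_mesh M" and t: "t \<in> T" and h: "separable M T t h h'"
  shows "((\<lambda>s. dom_integral M (h s)) has_real_derivative dom_integral M h') (at t within T)"
  using h
proof induction
  case (product a a' E)
  then show ?case by (auto simp: dom_integral_cmult intro!: derivative_eq_intros)
next
  case (add h h' k k')
  have "((\<lambda>s. dom_integral M (h s) + dom_integral M (k s)) has_real_derivative
     dom_integral M h' + dom_integral M k') (at t within T)"
    by (rule DERIV_add[OF add.IH])
  also have "dom_integral M h' + dom_integral M k' = dom_integral M (\<lambda>x. h' x + k' x)"
    using separable_bounded_measurable[OF add.hyps(1)] separable_bounded_measurable[OF add.hyps(2)] by (simp add: dom_integral_add[OF M])
  finally show ?case
    by (rule has_field_derivative_transform_within[OF _ zero_less_one t])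
       (simp add: dom_integral_add[OF M separable_bounded_measurable(2)[OF add.hyps(1)] separable_bounded_measurable(2)[OF add.hyps(2)]])
next
  case (cong h h' k k')
  have e: "dom_integral M k' = dom_integral M h'" using cong.hyps by (intro dom_integral_cong) auto
  show ?case unfolding e
    by (rule has_field_derivative_transform_within[OF cong.IH zero_less_one t])
       (rule dom_integral_cong, simp only: cong.hyps)
qed

text \<open>The coefficients are point samples of \<open>f\<close>, so they inherit its pointwise
  differentiability; in particular the time derivative agrees on the cells with an element of
  the same space.\<close>

lemma time_representation:
  fixes f :: "real \<Rightarrow> point \<Rightarrow> 'b::real_inner"
  assumes W: "fin_dim_space W" "\<And>s. s \<in> T \<Longrightarrow> f s \<in> W" and d: "time_differentiable M T f"
    and t: "t \<in> T" "at t within T \<noteq> bot"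
  obtains N :: nat and a a' e where
    "\<And>j. j < N \<Longrightarrow> e j \<in> W" "\<And>j. j < N \<Longrightarrow> (a j has_real_derivative a' j) (at t within T)"
    "\<And>s x. s \<in> T \<Longrightarrow> x \<in> \<Union>(cells M) \<Longrightarrow> f s x = (\<Sum>j<N. a j s *\<^sub>R e j x)"
    "\<And>x. x \<in> \<Union>(cells M) \<Longrightarrow> dt T f t x = (\<Sum>j<N. a' j *\<^sub>R e j x)"
    "(\<lambda>x. \<Sum>j<N. a' j *\<^sub>R e j x) \<in> W"
proof -
  let ?S = "\<Union>(cells M)"
  obtain B where B: "finite B" "W = function_span B" using W(1) unfolding fin_dim_space_def function_span_def by blast
  obtain N :: nat and X d e where X: "\<And>j. j < N \<Longrightarrow> X j \<in> ?S \<and> e j \<in> function_span B"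
    and rep: "\<And>f x. f \<in> function_span B \<Longrightarrow> x \<in> ?S \<Longrightarrow> f x = (\<Sum>j<N. (f (X j) \<bullet> d j) *\<^sub>R e j x)"
    using sampling_representation[OF B(1), of ?S] by blast
  have vd: "((\<lambda>s. f s x) has_vector_derivative dt T f t x) (at t within T)" if "x \<in> ?S" for x
    using d[unfolded time_differentiable_def, rule_format, OF t(1) that]
    unfolding dt_def vector_derivative_works .
  define a where "a j s = f s (X j) \<bullet> d j" for j s
  define a' where "a' j = dt T f t (X j) \<bullet> d j" for j
  have ad: "(a j has_real_derivative a' j) (at t within T)" if "j < N" for j
  proof -
    have "((\<lambda>s. f s (X j)) has_vector_derivative dt T f t (X j)) (at t within T)" using vd X[OF that] by blast
    then have "((\<lambda>s. f s (X j) \<bullet> d j) has_vector_derivative dt T f t (X j) \<bullet> d j) (at t within T)"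
      by (rule bounded_linear.has_vector_derivative[OF bounded_linear_inner_left])
    then show ?thesis unfolding a_def[abs_def] a'_def has_real_derivative_iff_has_vector_derivative .
  qed
  have rp: "f s x = (\<Sum>j<N. a j s *\<^sub>R e j x)" if "s \<in> T" "x \<in> ?S" for s x
    using rep[of "f s" x] W(2) B(2) that unfolding a_def by blast
  have "dt T f t x = (\<Sum>j<N. a' j *\<^sub>R e j x)" if x: "x \<in> ?S" for x
  proof -
    have "((\<lambda>s. \<Sum>j<N. a j s *\<^sub>R e j x) has_vector_derivative (\<Sum>j<N. a' j *\<^sub>R e j x)) (at t within T)"
      by (rule has_vector_derivative_sum)
         (use ad in \<open>auto intro!: bounded_linear.has_vector_derivative[OF bounded_linear_scaleR_left]
            simp: has_real_derivative_iff_has_vector_derivative\<close>)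
    then have "((\<lambda>s. f s x) has_vector_derivative (\<Sum>j<N. a' j *\<^sub>R e j x)) (at t within T)"
      by (rule has_vector_derivative_transform[OF t(1), rotated]) (use rp x in auto)
    with vd[OF x] show ?thesis using t(2) vector_derivative_unique_within by blast
  qed
  moreover have "(\<lambda>x. \<Sum>j<N. a' j *\<^sub>R e j x) \<in> W" using X unfolding B(2) by (intro function_span_sum) blast
  ultimately show ?thesis using that[of N e a a'] X ad rp unfolding B(2) by blast
qed

section \<open>Energy balance\<close>

lemma trace_from_cong:
  assumes "\<And>y. y \<in> K \<Longrightarrow> f y = g y"
  shows "trace_from K f x = trace_from K g x"
proof -
  have "(f \<longlongrightarrow> l) (at x within K) \<longleftrightarrow> (g \<longlongrightarrow> l) (at x within K)" for l
    by (rule filterlim_cong[OF refl refl]) (simp add: eventually_at_filter assms)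
  then show ?thesis unfolding trace_from_def t2_space_class.Lim_def by simp
qed

lemma facet_integral_eq_0:
  assumes "\<And>F x. F \<in> ifacets M \<Longrightarrow> x \<in> surf F \<Longrightarrow> h F x = 0"
  shows "facet_integral M h = 0"
proof -
  have "set_lebesgue_integral surface_measure (surf F) (h F) = 0" if "F \<in> ifacets M" for F
  proof -
    have "(\<lambda>x. indicator (surf F) x *\<^sub>R h F x) = (\<lambda>x. 0)"
      using assms[OF that] by (auto simp: indicator_def fun_eq_iff)
    then show ?thesis by (simp add: set_lebesgue_integral_def)
  qed
  then show ?thesis by (simp add: facet_integral_def)
qed

lemma facet_traces:
  assumes M: "fe_mesh M" and F: "F \<in> ifacets M" and x: "x \<in> surf F"
  shows "plus_cell F \<in> all_cells M" "minus_cell F \<in> all_cells M"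
    "trp F (\<lambda>y. c) x = c" "trm F (\<lambda>y. c) x = c"
proof -
  have "interior_facet_of M F" using fe_meshD(6)[OF M F] .
  then have c: "plus_cell F \<in> all_cells M" "minus_cell F \<in> all_cells M"
     "x \<in> frontier (plus_cell F)" "x \<in> frontier (minus_cell F)"
    using x unfolding interior_facet_of_def by blast+
  show "plus_cell F \<in> all_cells M" "minus_cell F \<in> all_cells M" using c by auto
  have o: "open (plus_cell F)" "open (minus_cell F)"
    by (rule all_cellsE[OF M c(1)], assumption, rule all_cellsE[OF M c(2)], assumption)
  show "trp F (\<lambda>y. c) x = c" "trm F (\<lambda>y. c) x = c"
    using trace_from_eq[OF o(1) c(3), of "\<lambda>y. c" "\<lambda>y. c"] trace_from_eq[OF o(2) c(4), of "\<lambda>y. c" "\<lambda>y. c"] by auto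
qed

lemma periodic_eq_const_all_cells:
  assumes q: "periodic_field M q" "\<And>x. x \<in> \<Union>(cells M) \<Longrightarrow> q x = c" and K: "K \<in> all_cells M" "y \<in> K"
  shows "q y = c"
proof -
  obtain v K0 x where v: "v \<in> lattice_of M" "K0 \<in> cells M" "x \<in> K0" "y = v + x"
    using K unfolding all_cells_def by blast
  have "x \<in> \<Union>(cells M)" using v by blast
  then have "q (v + x) = q x" "q x = c" using q v(1) unfolding periodic_field_def by blast+
  then show ?thesis using v(4) by simp
qed

text \<open>With \<open>w = V\<close> the advected field is \<open>m_i n (V \<times> V) = 0\<close>, so both advection terms drop
  out.\<close>

lemma momentum_self_test:
  assumes M: "fe_mesh M" and w: "V \<in> V2_ring M V2"
    and mom: "momentum_eq M V2 mi V' n V p P"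
  shows "dom_inner M (\<lambda>x. (mi * n x) *\<^sub>R V x) V'
    + dom_inner M (grad P) (\<lambda>x. n x *\<^sub>R V x)
    - facet_integral M (\<lambda>F x. jump F (\<lambda>y. P y *\<^sub>R V y) x * upwind F V n x)
    - dom_inner M p (divergence V) = 0"
proof -
  have z: "(\<lambda>x. cross3 ((mi * n x) *\<^sub>R V x) (V x)) = (\<lambda>x. 0)"
    by (simp add: cross_mult_left)
  have "curl (\<lambda>x. 0) x = 0" for x
    by (simp add: curl_def pd_const vec_eq_iff forall_3)
  then have c: "dom_inner M (curl (\<lambda>x. 0)) V = 0"
    by (simp add: dom_inner_def dom_integral_def)
  have t: "facet_integral M (\<lambda>F x. tangential_jump F (\<lambda>y. 0) x \<bullet> upwind F V V x) = 0"
    by (rule facet_integral_eq_0) (simp add: tangential_jump_def facet_traces[OF M])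
  from bspec[OF mom[unfolded momentum_eq_def] w] show ?thesis unfolding z c t by simp
qed

text \<open>For \<open>\<phi> = 1\<close> the gradient vanishes and the facet term reduces to the normal jump of
  \<open>V\<close>, which is zero by conformity in \<open>H(div)\<close>.  The test function is 1 on the
  representative cells; periodicity carries this to their translates next to a facet.\<close>

lemma pressure_constant_test:
  assumes M: "fe_mesh M" and q: "q \<in> V3" "cellwise_smooth M q" "\<And>x. x \<in> \<Union>(cells M) \<Longrightarrow> q x = 1"
    and V: "cellwise_smooth M V" "V \<in> Hdiv M"
    and pr: "pressure_eq M V3 \<gamma> p' V p"
  shows "dom_integral M (\<lambda>x. p' x / (\<gamma> - 1)) + dom_inner M p (divergence V) = 0"
proof -
  have a: "dom_inner M (\<lambda>x. q x / (\<gamma> - 1)) p' = dom_integral M (\<lambda>x. p' x / (\<gamma> - 1))"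
    unfolding dom_inner_def by (rule dom_integral_cong) (use q(3) in simp)
  have g: "grad q x = 0" if "x \<in> \<Union>(cells M)" for x
  proof -
    have "(q has_derivative (\<lambda>h. 0)) (at x)"
      by (rule has_derivative_transform_within_open[of "\<lambda>x. 1" _ _ UNIV "\<Union>(cells M)"])
         (use q(3) that cells_open[OF M] in auto)
    from pd_eqI[OF this] show ?thesis by (simp add: grad_def vec_eq_iff)
  qed
  have "dom_inner M (\<lambda>x. (1 / (\<gamma> - 1)) *\<^sub>R grad q x) (\<lambda>x. p x *\<^sub>R V x) = dom_integral M (\<lambda>x. 0)"
    unfolding dom_inner_def by (rule dom_integral_cong) (simp only: g scaleR_zero_right inner_zero_left)
  then have b: "dom_inner M (\<lambda>x. (1 / (\<gamma> - 1)) *\<^sub>R grad q x) (\<lambda>x. p x *\<^sub>R V x) = 0"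
    by (simp add: dom_integral_def)
  have c: "facet_integral M (\<lambda>F x. 1 / (\<gamma> - 1) * jump F (\<lambda>y. q y *\<^sub>R V y) x * upwind F V p x) = 0"
  proof (rule facet_integral_eq_0)
    fix F x assume F: "F \<in> ifacets M" "x \<in> surf F"
    have q1: "q y = 1" if "y \<in> K" "K \<in> all_cells M" for y K
      by (rule periodic_eq_const_all_cells[OF conjunct1[OF q(2)[unfolded cellwise_smooth_def]] q(3) that(2,1)])
    have "trp F (\<lambda>y. q y *\<^sub>R V y) x = trp F V x" "trm F (\<lambda>y. q y *\<^sub>R V y) x = trm F V x"
      by (rule trace_from_cong; use q1 facet_traces(1,2)[OF M F] in simp)+
    then have "jump F (\<lambda>y. q y *\<^sub>R V y) x = jump F V x" by (simp add: jump_def)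
    then show "1 / (\<gamma> - 1) * jump F (\<lambda>y. q y *\<^sub>R V y) x * upwind F V p x = 0"
      using normal_jump_eq_0[OF M F V] by simp
  qed
  have d: "dom_inner M (\<lambda>x. q x * p x) (divergence V) = dom_inner M p (divergence V)"
    unfolding dom_inner_def by (rule dom_integral_cong) (use q(3) in simp)
  from bspec[OF pr[unfolded pressure_eq_def] q(1)] show ?thesis unfolding a b c d by simp
qed

theorem mainTheorem9:
  fixes M :: mesh
    and V2 :: "(real^3 \<Rightarrow> real^3) set" and V3 :: "(real^3 \<Rightarrow> real) set"
    and mi \<gamma> :: real and T :: "real set"
    and n p :: "real \<Rightarrow> real^3 \<Rightarrow> real" and V :: "real \<Rightarrow> real^3 \<Rightarrow> real^3"
  assumes "fe_mesh M"
    and "fe_spaces M V2 V3"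
    and "mi > 0" and "\<gamma> = 5 / 3"
    and "is_interval T" and "interior T \<noteq> {}"
    and "hydro_solution M V2 V3 mi \<gamma> T n V p"
  shows "\<forall>t\<in>T. ((\<lambda>s. hydro_energy M mi \<gamma> (n s) (V s) (p s)) has_real_derivative 0) (at t within T)"
proof
  fix t assume t: "t \<in> T"
  note M = assms(1)
  note sp = assms(2)[unfolded fe_spaces_def]
  note sol = assms(7)[unfolded hydro_solution_def]
  let ?S = "\<Union>(cells M)"
  have V2: "fin_dim_space V2" "\<And>w. w \<in> V2 \<Longrightarrow> cellwise_smooth M w" "V2 \<subseteq> Hdiv M"
    and V3: "fin_dim_space V3" "\<And>\<phi>. \<phi> \<in> V3 \<Longrightarrow> cellwise_smooth M \<phi>"
    and one: "\<exists>q\<in>V3. \<forall>x\<in>?S. q x = 1"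
    using sp by auto
  have td: "time_differentiable M T n" "time_differentiable M T V" "time_differentiable M T p"
    and inV: "\<And>s. s \<in> T \<Longrightarrow> n s \<in> V3" "\<And>s. s \<in> T \<Longrightarrow> V s \<in> V2_ring M V2" "\<And>s. s \<in> T \<Longrightarrow> p s \<in> V3"
    and cont: "continuity_eq M V3 (dt T n t) (n t) (V t)"
    and pres: "pressure_eq M V3 \<gamma> (dt T p t) (V t) (p t)"
    using sol t by auto
  obtain P where P: "P \<in> V3" "\<And>\<phi>. \<phi> \<in> V3 \<Longrightarrow> dom_inner M \<phi> (\<lambda>x. P x - mi / 2 * (norm (V t x))\<^sup>2) = 0"
    and mom: "momentum_eq M V2 mi (dt T V t) (n t) (V t) (p t) P"
    using sol t by blast
  have Vin: "V s \<in> V2" if "s \<in> T" for s using inV(2)[OF that] unfolding V2_ring_def by blast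
  have bot: "at t within T \<noteq> bot"
  proof -
    have "T \<noteq> {t}" using assms(6) by auto
    then have "t islimpt T"
      using connected_imp_perfect[of T t] is_interval_connected[OF assms(5)] t by blast
    then show ?thesis by (simp add: trivial_limit_within)
  qed

  have scal: "separable M T t f (dt T f t) \<and> (\<exists>q\<in>V3. \<forall>x\<in>?S. q x = dt T f t x)"
    if f: "\<And>s. s \<in> T \<Longrightarrow> f s \<in> V3" "time_differentiable M T f" for f :: "real \<Rightarrow> point \<Rightarrow> real"
  proof -
    obtain N :: nat and a a' e where r: "\<And>j. j < N \<Longrightarrow> e j \<in> V3" "\<And>j. j < N \<Longrightarrow> (a j has_real_derivative a' j) (at t within T)"
      "\<And>s x. s \<in> T \<Longrightarrow> x \<in> ?S \<Longrightarrow> f s x = (\<Sum>j<N. a j s *\<^sub>R e j x)"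
      "\<And>x. x \<in> ?S \<Longrightarrow> dt T f t x = (\<Sum>j<N. a' j *\<^sub>R e j x)" "(\<lambda>x. \<Sum>j<N. a' j *\<^sub>R e j x) \<in> V3"
      by (rule time_representation[OF V3(1) f t bot]) (assumption, rule that)
    have "bounded_measurable M (e j)" if "j < N" for j
      using bounded_measurable_cellwise_smooth[OF M V3(2)[OF r(1)[OF that]], of 1] by simp
    then have "separable M T t (\<lambda>s x. \<Sum>j<N. a j s * e j x) (\<lambda>x. \<Sum>j<N. a' j * e j x)"
      using r(2) by (intro separable_sum[OF M]) blast
    then have "separable M T t f (dt T f t)" by (rule separable.cong) (simp_all only: r(3,4) real_scaleR_def)
    moreover have "\<exists>q\<in>V3. \<forall>x\<in>?S. q x = dt T f t x" 
      by (intro bexI[OF _ r(5)] ballI) (rule r(4)[symmetric])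
    ultimately show ?thesis by blast
  qed
  note sn = scal[OF inV(1) td(1)] and sp = scal[OF inV(3) td(3)]
  have sV: "separable M T t (\<lambda>s x. V s x $ i) (\<lambda>x. dt T V t x $ i)" for i
  proof -
    obtain N :: nat and a a' e where r: "\<And>j. j < N \<Longrightarrow> e j \<in> V2" "\<And>j. j < N \<Longrightarrow> (a j has_real_derivative a' j) (at t within T)"
      "\<And>s x. s \<in> T \<Longrightarrow> x \<in> ?S \<Longrightarrow> V s x = (\<Sum>j<N. a j s *\<^sub>R e j x)"
      "\<And>x. x \<in> ?S \<Longrightarrow> dt T V t x = (\<Sum>j<N. a' j *\<^sub>R e j x)" "(\<lambda>x. \<Sum>j<N. a' j *\<^sub>R e j x) \<in> V2"
      by (rule time_representation[OF V2(1) Vin td(2) t bot]) (assumption, rule that)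
    have "bounded_measurable M (\<lambda>x. e j x $ i)" if "j < N" for j
      using bounded_measurable_cellwise_smooth[OF M V2(2)[OF r(1)[OF that]], of "axis i 1"] by (simp add: inner_axis)
    then have "separable M T t (\<lambda>s x. \<Sum>j<N. a j s * (e j x $ i)) (\<lambda>x. \<Sum>j<N. a' j * (e j x $ i))"
      using r(2) by (intro separable_sum[OF M]) blast
    then show ?thesis
      by (rule separable.cong) (simp_all only: r(3,4) sum_component vector_scaleR_component real_scaleR_def)
  qed
  define n' where "n' = dt T n t"
  define p' where "p' = dt T p t"
  define V' where "V' = dt T V t"
  note s = sn[THEN conjunct1, folded n'_def] sp[THEN conjunct1, folded p'_def] sV[folded V'_def]
  have "separable M T t (\<lambda>s x. V s x $ 1 * V s x $ 1 + V s x $ 2 * V s x $ 2 + V s x $ 3 * V s x $ 3)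
     (\<lambda>x. (V' x $ 1 * V t x $ 1 + V t x $ 1 * V' x $ 1) + (V' x $ 2 * V t x $ 2 + V t x $ 2 * V' x $ 2)
        + (V' x $ 3 * V t x $ 3 + V t x $ 3 * V' x $ 3))"
    by (intro separable.add separable_mult[OF t] s)
  then have sq: "separable M T t (\<lambda>s x. (norm (V s x))\<^sup>2) (\<lambda>x. 2 * (V t x \<bullet> V' x))"
    by (rule separable.cong) (simp_all add: power2_norm_eq_inner inner_vec_def sum_3)
  note sc = separable_const[OF M, of T t]
  have "separable M T t (\<lambda>s x. mi / 2 * (n s x * (norm (V s x))\<^sup>2) + 1 / (\<gamma> - 1) * p s x)
    (\<lambda>x. (0 * (n t x * (norm (V t x))\<^sup>2) + mi / 2 * (n' x * (norm (V t x))\<^sup>2 + n t x * (2 * (V t x \<bullet> V' x))))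
       + (0 * p t x + 1 / (\<gamma> - 1) * p' x))"
    by (intro separable.add separable_mult[OF t] s sq sc)
  from separable_derivative[OF M t this]
  have D: "((\<lambda>s. hydro_energy M mi \<gamma> (n s) (V s) (p s)) has_real_derivative
     dom_integral M (\<lambda>x. (mi / 2 * (n' x * (norm (V t x))\<^sup>2) + mi * (n t x * (V t x \<bullet> V' x))) + p' x / (\<gamma> - 1))) (at t within T)"
    by (simp add: hydro_energy_def algebra_simps)
  note c = separable_bounded_measurable(2)[OF sc t]
  have nV: "bounded_measurable M (\<lambda>x. V t x \<bullet> V' x)"
    using bounded_measurable_mult[OF c separable_bounded_measurable(1)[OF sq], of "1/2"] by simp
  have n1: "bounded_measurable M (\<lambda>x. mi / 2 * (n' x * (norm (V t x))\<^sup>2))"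
    by (rule bounded_measurable_mult[OF c bounded_measurable_mult[OF separable_bounded_measurable(1)[OF s(1)] separable_bounded_measurable(2)[OF sq t]]])
  have n2: "bounded_measurable M (\<lambda>x. mi * (n t x * (V t x \<bullet> V' x)))"
    by (rule bounded_measurable_mult[OF c bounded_measurable_mult[OF separable_bounded_measurable(2)[OF s(1) t] nV]])
  have n3: "bounded_measurable M (\<lambda>x. p' x / (\<gamma> - 1))"
    using bounded_measurable_mult[OF separable_bounded_measurable(1)[OF s(2)] c, of "1 / (\<gamma> - 1)"] by simp
  have split: "dom_integral M (\<lambda>x. (mi / 2 * (n' x * (norm (V t x))\<^sup>2) + mi * (n t x * (V t x \<bullet> V' x))) + p' x / (\<gamma> - 1))
     = dom_integral M (\<lambda>x. mi / 2 * (n' x * (norm (V t x))\<^sup>2)) + dom_integral M (\<lambda>x. mi * (n t x * (V t x \<bullet> V' x)))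
      + dom_integral M (\<lambda>x. p' x / (\<gamma> - 1))"
    using dom_integral_add[OF M bounded_measurable_add[OF n1 n2] n3] dom_integral_add[OF M n1 n2] by simp
  \<comment> \<open>The time derivative of the density is itself an admissible test function in the definition
    of \<open>P\<close>.\<close>
  have e1: "dom_integral M (\<lambda>x. mi / 2 * (n' x * (norm (V t x))\<^sup>2)) = dom_inner M P n'"
  proof -
    obtain q where q: "q \<in> V3" "\<And>x. x \<in> ?S \<Longrightarrow> q x = n' x" using sn unfolding n'_def by blast
    have "bounded_measurable M P" using bounded_measurable_cellwise_smooth[OF M V3(2)[OF P(1)], of 1] by simp
    then have nP: "bounded_measurable M (\<lambda>x. P x * n' x)" by (rule bounded_measurable_mult[OF _ separable_bounded_measurable(1)[OF s(1)]])
    have n1': "bounded_measurable M (\<lambda>x. - 1 * (mi / 2 * (n' x * (norm (V t x))\<^sup>2)))" by (rule bounded_measurable_mult[OF c n1])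
    have "0 = dom_inner M q (\<lambda>x. P x - mi / 2 * (norm (V t x))\<^sup>2)" using P(2)[OF q(1)] by simp
    also have "\<dots> = dom_integral M (\<lambda>x. P x * n' x + - 1 * (mi / 2 * (n' x * (norm (V t x))\<^sup>2)))"
      unfolding dom_inner_def by (rule dom_integral_cong) (simp add: q(2) algebra_simps)
    also have "\<dots> = dom_integral M (\<lambda>x. P x * n' x) - dom_integral M (\<lambda>x. mi / 2 * (n' x * (norm (V t x))\<^sup>2))"
      unfolding dom_integral_add[OF M nP n1'] dom_integral_cmult by simp
    finally show ?thesis by (simp add: dom_inner_def)
  qed
  have e2: "dom_integral M (\<lambda>x. mi * (n t x * (V t x \<bullet> V' x))) = dom_inner M (\<lambda>x. (mi * n t x) *\<^sub>R V t x) V'"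
    by (simp add: dom_inner_def mult.assoc)
  have e3: "dom_inner M P n' - dom_inner M (grad P) (\<lambda>x. n t x *\<^sub>R V t x)
      + facet_integral M (\<lambda>F x. jump F (\<lambda>y. P y *\<^sub>R V t y) x * upwind F (V t) (n t) x) = 0"
    using cont P(1) unfolding continuity_eq_def n'_def by blast
  note e4 = momentum_self_test[OF M inV(2)[OF t] mom, folded V'_def]
  obtain q where q: "q \<in> V3" "\<And>x. x \<in> ?S \<Longrightarrow> q x = 1" using one by blast
  have Vh: "V t \<in> Hdiv M" using V2(3) Vin[OF t] by blast
  note e5 = pressure_constant_test[OF M q(1) V3(2)[OF q(1)] q(2) V2(2)[OF Vin[OF t]] Vh pres, folded p'_def]
  have "dom_integral M (\<lambda>x. (mi / 2 * (n' x * (norm (V t x))\<^sup>2) + mi * (n t x * (V t x \<bullet> V' x))) + p' x / (\<gamma> - 1)) = 0"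
    unfolding split e1 e2 using e3 e4 e5 by linarith
  with D show "((\<lambda>s. hydro_energy M mi \<gamma> (n s) (V s) (p s)) has_real_derivative 0) (at t within T)" by simp
qed

end
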